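(* Let $(X,\mathbb{Z}^k,T)$ be a dynamical system with the marker property and $\mathrm{mdim}(X)=0$. Then the set of continuous functions $f:X\to\mathbb{R}$ satisfying $\mathrm{ocap}(\{x\in X: f(x)=0\})=0$ is a dense $G_\delta$ subset of $C(X)$.
   Context: $C(X)$ is the Banach space of real continuous functions with the sup norm. Orbit capacity of $A\subset X$: $\mathrm{ocap}(A)=\lim_{N\to\infty}N^{-k}\sup_{x\in X}\sum_{n\in[N]}1_A(T^nx)$, $[N]=\{0,\dots,N-1\}^k$. Marker property: for every finite $F\subset\mathbb{Z}^k$ there is an open $U$ with $X=\bigcup_nT^nU$ and $U\cap T^nU=\emptyset$ for nonzero $n\in F$. Mean dimension: with $d_\Omega(x,y)=\sup_{n\in\Omega}d(T^nx,T^ny)$, $\mathrm{widim}_\varepsilon(X,d)$ the minimal dimension of a finite simplicial complex admitting a continuous map whose fibers have $d$-diameter $<\varepsilon$, $\mathrm{mdim}(X)=\lim_{\varepsilon\to0}\lim_{N\to\infty}N^{-k}\mathrm{widim}_\varepsilon(X,d_{[N]})$. *)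

theory Defs
  imports "HOL-Analysis.Analysis"
begin

definition zk_system :: "(int ^ 'k \<Rightarrow> 'a::metric_space \<Rightarrow> 'a) \<Rightarrow> bool" where
  "zk_system T \<longleftrightarrow> compact (UNIV :: 'a set) \<and> T 0 = id \<and>
     (\<forall>m n. T (m + n) = T m \<circ> T n) \<and> (\<forall>n. continuous_on UNIV (T n))"

definition box :: "nat \<Rightarrow> (int ^ 'k) set" where
  "box N = {n. \<forall>i. 0 \<le> n $ i \<and> n $ i < int N}"

definition ocap :: "(int ^ 'k \<Rightarrow> 'a \<Rightarrow> 'a) \<Rightarrow> 'a set \<Rightarrow> real" where
  "ocap T A = lim (\<lambda>N. (SUP x. (\<Sum>n\<in>box N. indicator A (T n x))) / real N ^ CARD('k))"

definition marker_property :: "(int ^ 'k \<Rightarrow> 'a::topological_space \<Rightarrow> 'a) \<Rightarrow> bool" where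
  "marker_property T \<longleftrightarrow> (\<forall>F. finite F \<longrightarrow> (\<exists>U. open U \<and> (\<Union>n. T n ` U) = UNIV \<and>
       (\<forall>n\<in>F. n \<noteq> 0 \<longrightarrow> U \<inter> T n ` U = {})))"

definition dyn_dist :: "(int ^ 'k \<Rightarrow> 'a::metric_space \<Rightarrow> 'a) \<Rightarrow> (int ^ 'k) set \<Rightarrow> 'a \<Rightarrow> 'a \<Rightarrow> real" where
  "dyn_dist T \<Omega> x y = (SUP n\<in>\<Omega>. dist (T n x) (T n y))"

text \<open>Finite simplicial complexes: an abstract finite simplicial complex \<open>K\<close> with vertices
  in \<open>nat\<close> (nonempty finite vertex sets, closed under nonempty subsets), and its standard
  geometric realisation inside \<open>nat \<Rightarrow> real\<close> (product topology): points are
  barycentric coordinate functions whose support is a simplex of \<open>K\<close>.\<close>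
definition fin_simplicial_complex :: "nat set set \<Rightarrow> bool" where
  "fin_simplicial_complex K \<longleftrightarrow> finite K \<and> (\<forall>\<sigma>\<in>K. finite \<sigma> \<and> \<sigma> \<noteq> {}) \<and>
     (\<forall>\<sigma>\<in>K. \<forall>\<tau>. \<tau> \<subseteq> \<sigma> \<and> \<tau> \<noteq> {} \<longrightarrow> \<tau> \<in> K)"

definition realization :: "nat set set \<Rightarrow> (nat \<Rightarrow> real) set" where
  "realization K = {p. (\<forall>i. 0 \<le> p i) \<and> {i. p i \<noteq> 0} \<in> K \<and> (\<Sum>i\<in>{i. p i \<noteq> 0}. p i) = 1}"

definition complex_dim :: "nat set set \<Rightarrow> nat" where
  "complex_dim K = Max ({0} \<union> {card \<sigma> - 1 | \<sigma>. \<sigma> \<in> K})"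

definition widim :: "real \<Rightarrow> ('a::topological_space \<Rightarrow> 'a \<Rightarrow> real) \<Rightarrow> nat" where
  "widim \<epsilon> d = Inf {complex_dim K | K. fin_simplicial_complex K \<and>
     (\<exists>f :: 'a \<Rightarrow> (nat \<Rightarrow> real). continuous_on UNIV f \<and> range f \<subseteq> realization K \<and>
        (\<forall>p\<in>range f. (SUP xy\<in>(f -` {p}) \<times> (f -` {p}). d (fst xy) (snd xy)) < \<epsilon>))}"

text \<open>Mean dimension (with values in the extended reals, since it may be infinite).\<close>
definition mdim :: "(int ^ 'k \<Rightarrow> 'a::metric_space \<Rightarrow> 'a) \<Rightarrow> ereal" where
  "mdim T = Lim (at_right 0) (\<lambda>\<epsilon>. ereal (lim (\<lambda>N.
      real (widim \<epsilon> (dyn_dist T (box N))) / real N ^ CARD('k))))"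

end

theory Submission
  imports Defs
begin

text \<open>The set in question is the countable intersection of the open sets of functions whose zero set
  is visited with frequency less than \<open>1 / m\<close> in some box, so by Baire it suffices to approximate
  \<open>f\<close> by functions \<open>g\<close> with few zeros along every orbit.

  Mean dimension zero yields a box of side \<open>M\<close> whose orbit segments are described, up to small
  errors, by a map to a complex of dimension much smaller than \<open>M ^ k\<close>. Hence the vector
  \<open>(f (T i x))\<close>, \<open>i\<close> in the box, is uniformly approximated by a vector depending on \<open>x\<close> in a Lipschitz
  way through this complex, and after adding generic constants at most (dimension of the complex)
  many of its coordinates vanish simultaneously. It remains to lay out such patterns along disjoint
  boxes covering most of every orbit, depending continuously on \<open>x\<close>. The visits of \<open>x\<close> to a marker set
  are the sites of a power diagram whose weights are large when the marker function is small. Since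
  sites are far apart, comparing the diagram with its copy for slightly larger weights shows
  that most of the space lies well inside the cells. Blending between cells
  affects only the remaining small proportion.

  That the limits in the definitions exist has to be checked as well, since an unspecified value of a
  divergent limit could vanish. For the mean dimension this is the subadditivity of the width
  dimension, which rests on a triangulation of products of simplices by the monotone coupling.\<close>

section \<open>Box averages and orbit capacity\<close>

text \<open>Subadditivity turns the limits over boxes into infima. Hence \<open>ocap\<close>
  vanishes iff each threshold is met by some single box, a condition on finitely many times of each
  orbit and therefore open in \<open>f\<close>. Dimension enters through general position:
  \<open>d + 1\<close> equations on a space of dimension \<open>d\<close> generically have no common
  solution, so a pattern of \<open>M ^ k\<close> values governed by \<open>d\<close> parameters has
  at most \<open>d\<close> zeros. The obstacle is continuity. Sites must be able to appear and
  disappear as \<open>x\<close> varies, while the function built from them may not jump. A weight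
  that rises to \<open>C\<close> as the marker function falls to 0 deprives a site of its cell
  before it vanishes, and where sites nearly tie their patterns are averaged. Averages stay close to
  \<open>f\<close> but may create zeros, so all such points are counted as zeros. The resulting
  frequency has three sources: \<open>d / M ^ k\<close> inside the tiles,
  \<open>1 - (M / (M + 1)) ^ k\<close> for what the tiles miss, and a boundary term that tends to 0
  as \<open>N\<close> grows with \<open>M\<close> fixed.\<close>

lemma mem_box: "n \<in> box N \<longleftrightarrow> (\<forall>i. 0 \<le> n $ i \<and> n $ i < int N)"
  by (simp add: box_def)

lemma bij_betw_box:
  "bij_betw (\<lambda>n. \<chi> i. z + n i) (PiE UNIV (\<lambda>_::'k. {0..<int N})) {n :: int ^ 'k. \<forall>i. z \<le> n $ i \<and> n $ i < z + int N}"
proof (rule bij_betwI[where g = "\<lambda>n i. n $ i - z"])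
qed (auto simp: PiE_def Pi_def extensional_def vec_eq_iff diff_less_eq add.commute)

lemma finite_cube [simp]: "finite {n :: int ^ 'k. \<forall>i. z \<le> n $ i \<and> n $ i < z + int N}"
  using bij_betw_finite[OF bij_betw_box[where 'k = 'k and z = z and N = N]]
  by (simp add: finite_PiE)

lemma card_cube: "card {n :: int ^ 'k. \<forall>i. z \<le> n $ i \<and> n $ i < z + int N} = N ^ CARD('k)"
  using bij_betw_same_card[OF bij_betw_box[where 'k = 'k and z = z and N = N]]
  by (simp add: card_PiE)

lemma finite_box [simp]: "finite (box N :: (int ^ 'k) set)"
  using finite_cube[of 0 N] by (simp add: box_def)

lemma card_box: "card (box N :: (int ^ 'k) set) = N ^ CARD('k)"
  using card_cube[of 0 N] by (simp add: box_def)

lemma box_eq_empty_iff: "(box N :: (int ^ 'k) set) = {} \<longleftrightarrow> N = 0"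
  by (simp add: card_box flip: card_0_eq)

lemma box_subset_translates:
  assumes "0 < M"
  shows "(box N :: (int ^ 'k) set) \<subseteq>
    (\<Union>j\<in>box ((N + M - 1) div M). (+) (\<chi> i. int M * j $ i) ` box M)"
proof
  fix n :: "int ^ 'k" assume n: "n \<in> box N"
  define j where "j = (\<chi> i. n $ i div int M)"
  define r where "r = (\<chi> i. n $ i mod int M)"
  have eq: "n = (\<chi> i. int M * j $ i) + r"
    by (simp add: vec_eq_iff j_def r_def)
  have "r \<in> box M" using assms by (simp add: mem_box r_def)
  moreover have "j \<in> box ((N + M - 1) div M)"
    unfolding mem_box
  proof
    fix i
    have n0: "0 \<le> n $ i" "n $ i \<le> int N - 1" using n by (auto simp: mem_box)
    have "int M * (n $ i div int M) + n $ i mod int M = n $ i" "0 \<le> n $ i mod int M"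
      using assms by simp_all
    then have "int M * (n $ i div int M) \<le> n $ i" by linarith
    then have "int M * (n $ i div int M + 1) \<le> int (N + M - 1)"
      using n0 assms by (simp add: algebra_simps)
    then have "int M * (n $ i div int M + 1) div int M \<le> int (N + M - 1) div int M"
      using assms by (intro zdiv_mono1) auto
    then have "n $ i div int M + 1 \<le> int (N + M - 1) div int M"
      using assms by (simp only: nonzero_mult_div_cancel_left of_nat_eq_0_iff)
    then show "0 \<le> j $ i \<and> j $ i < int ((N + M - 1) div M)"
      using n0 by (simp add: j_def zdiv_int pos_imp_zdiv_nonneg_iff assms)
  qed
  ultimately show "n \<in> (\<Union>j\<in>box ((N + M - 1) div M). (+) (\<chi> i. int M * j $ i) ` box M)"
    using eq by blast
qed

text \<open>\<open>box N\<close> is covered, not partitioned, by translates of \<open>box M\<close>,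
  with \<open>N / M\<close> rounded up in each direction; so the union bound must hold without
  disjointness. Nonemptiness is asked for because \<open>dyn_dist\<close> over the empty set is an
  unspecified supremum.\<close>

lemma box_subadditive:
  fixes s :: "(int ^ 'k) set \<Rightarrow> real"
  assumes mono: "\<And>A B. finite B \<Longrightarrow> A \<noteq> {} \<Longrightarrow> A \<subseteq> B \<Longrightarrow> s A \<le> s B"
    and sub: "\<And>A B. finite A \<Longrightarrow> finite B \<Longrightarrow> A \<noteq> {} \<Longrightarrow> B \<noteq> {} \<Longrightarrow> s (A \<union> B) \<le> s A + s B"
    and trans: "\<And>A m. finite A \<Longrightarrow> A \<noteq> {} \<Longrightarrow> s ((+) m ` A) \<le> s A"
    and "0 < M" "0 < N"
  shows "s (box N) \<le> real ((N + M - 1) div M) ^ CARD('k) * s (box M)"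
proof -
  define J :: "(int ^ 'k) set" where "J = box ((N + M - 1) div M)"
  define Q :: "int ^ 'k \<Rightarrow> (int ^ 'k) set" where "Q j = (+) (\<chi> i. int M * j $ i) ` box M" for j
  have M: "(box M :: (int ^ 'k) set) \<noteq> {}" using \<open>0 < M\<close> by (simp add: box_eq_empty_iff)
  have Q: "finite (Q j)" "Q j \<noteq> {}" for j using M by (auto simp: Q_def)
  have un: "s (\<Union>j\<in>I. Q j) \<le> real (card I) * s (box M)" if "finite I" "I \<noteq> {}" for I
    using that
  proof (induction rule: finite_ne_induct)
    case (singleton j)
    then show ?case using trans[of "box M"] M by (simp add: Q_def)
  next
    case (insert j I)
    have "s (Q j \<union> (\<Union>j\<in>I. Q j)) \<le> s (Q j) + s (\<Union>j\<in>I. Q j)"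
      using insert Q by (intro sub) auto
    also have "\<dots> \<le> s (box M) + real (card I) * s (box M)"
      using insert trans[of "box M"] M by (intro add_mono) (auto simp: Q_def)
    finally show ?case using insert by (simp add: algebra_simps)
  qed
  have sub: "box N \<subseteq> (\<Union>j\<in>J. Q j)"
    using box_subset_translates[OF \<open>0 < M\<close>] by (simp add: J_def Q_def)
  moreover have "(box N :: (int ^ 'k) set) \<noteq> {}" using \<open>0 < N\<close> by (simp add: box_eq_empty_iff)
  ultimately have "J \<noteq> {}" by auto
  have "s (box N) \<le> s (\<Union>j\<in>J. Q j)"
    using sub \<open>box N \<noteq> {}\<close> Q by (intro mono) (auto simp: J_def)
  also have "\<dots> \<le> real (card J) * s (box M)"
    using un \<open>J \<noteq> {}\<close> by (simp add: J_def)
  finally show ?thesis by (simp add: J_def card_box)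
qed

text \<open>Fekete's lemma for boxes. Rounding \<open>N / M\<close> up adds at most
  \<open>1 / N\<close> to the ratio of the sides, which disappears in the limit.\<close>

lemma quotient_limit:
  fixes a :: "nat \<Rightarrow> real"
  assumes nonneg: "\<And>N. 0 < N \<Longrightarrow> 0 \<le> a N"
    and sub: "\<And>M N. 0 < M \<Longrightarrow> 0 < N \<Longrightarrow> a N \<le> real ((N + M - 1) div M) ^ k * a M"
  shows "(\<lambda>N. a N / real N ^ k) \<longlonglongrightarrow> (INF M\<in>{1..}. a M / real M ^ k)"
proof (rule LIMSEQ_I)
  define I where "I = (INF M\<in>{1..}. a M / real M ^ k)"
  have bdd: "bdd_below ((\<lambda>M. a M / real M ^ k) ` {1..})"
    by (rule bdd_belowI2[where m = 0]) (auto intro!: divide_nonneg_nonneg nonneg)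
  fix e :: real assume "0 < e"
  then have "I < I + e" by simp
  then obtain M where M: "1 \<le> M" "a M / real M ^ k < I + e"
    unfolding I_def by (subst (asm) cINF_less_iff[OF _ bdd]) auto
  have "(\<lambda>N. (1 / real M + 1 / real N) ^ k * a M) \<longlonglongrightarrow> (1 / real M + 0) ^ k * a M"
    by (intro tendsto_intros lim_1_over_n)
  then have lim: "(\<lambda>N. (1 / real M + 1 / real N) ^ k * a M) \<longlonglongrightarrow> a M / real M ^ k"
    by (simp add: power_one_over)
  have "\<forall>\<^sub>F N in sequentially. (1 / real M + 1 / real N) ^ k * a M < I + e"
    using order_tendstoD(2)[OF lim M(2)] .
  then obtain N0 where N0: "\<And>N. N \<ge> N0 \<Longrightarrow> (1 / real M + 1 / real N) ^ k * a M < I + e"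
    by (auto simp: eventually_sequentially)
  have "norm (a N / real N ^ k - I) < e" if N: "N \<ge> max 1 N0" for N
  proof -
    have "real ((N + M - 1) div M) \<le> real (N + M - 1) / real M"
      by (simp add: of_nat_div_le_of_nat)
    also have "\<dots> \<le> (real N + real M) / real M"
      using M by (intro divide_right_mono) auto
    finally have q: "real ((N + M - 1) div M) / real N \<le> 1 / real M + 1 / real N"
      using N M by (simp add: field_simps)
    have "a N / real N ^ k \<le> (real ((N + M - 1) div M) / real N) ^ k * a M"
      using sub[of M N] N M by (simp add: power_divide divide_right_mono)
    also have "\<dots> \<le> (1 / real M + 1 / real N) ^ k * a M"
      using q nonneg[of M] M by (intro mult_right_mono power_mono) auto
    also have "\<dots> < I + e" using N0 N by simp
    finally have "a N / real N ^ k < I + e" .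
    moreover have "I \<le> a N / real N ^ k"
      unfolding I_def using N by (intro cINF_lower bdd) auto
    ultimately show ?thesis by simp
  qed
  then show "\<exists>no. \<forall>n\<ge>no. norm (a n / real n ^ k - (INF M\<in>{1..}. a M / real M ^ k)) < e"
    unfolding I_def by blast
qed

section \<open>Visits of orbits to a set\<close>

locale zk_action =
  fixes T :: "int ^ 'k \<Rightarrow> 'a::metric_space \<Rightarrow> 'a"
  assumes zk: "zk_system T"
begin

lemma compact_space: "compact (UNIV :: 'a set)"
  and T_zero: "T 0 x = x"
  and T_add: "T (m + n) x = T m (T n x)"
  and continuous_T: "continuous_on UNIV (T n)"
  using zk by (auto simp: zk_system_def fun_eq_iff)

definition visits :: "'a set \<Rightarrow> (int ^ 'k) set \<Rightarrow> real"
  where "visits A \<Omega> = (SUP x. \<Sum>n\<in>\<Omega>. indicator A (T n x))"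

lemma visits_upper: "(\<Sum>n\<in>\<Omega>. indicator A (T n x)) \<le> visits A \<Omega>"
  unfolding visits_def
proof (rule cSUP_upper)
  have "(\<Sum>n\<in>\<Omega>. indicator A (T n x)) \<le> (\<Sum>n\<in>\<Omega>. 1 :: real)" for x
    by (rule sum_mono) (simp add: indicator_def)
  then show "bdd_above (range (\<lambda>x. \<Sum>n\<in>\<Omega>. indicator A (T n x) :: real))"
    by (auto intro!: bdd_aboveI2)
qed simp

lemma visits_least: "(\<And>x. (\<Sum>n\<in>\<Omega>. indicator A (T n x)) \<le> c) \<Longrightarrow> visits A \<Omega> \<le> c"
  unfolding visits_def by (rule cSUP_least) auto

lemma visits_nonneg: "0 \<le> visits A \<Omega>"
  by (rule order_trans[OF _ visits_upper[where x = undefined]]) (simp add: sum_nonneg)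

lemma visits_quotient_limit:
  "(\<lambda>N. visits A (box N) / real N ^ CARD('k)) \<longlonglongrightarrow> (INF M\<in>{1..}. visits A (box M) / real M ^ CARD('k))"
proof (rule quotient_limit[OF visits_nonneg], rule box_subadditive)
  show "visits A B \<le> visits A C" if "finite C" "B \<subseteq> C" for B C
  proof (rule visits_least)
    fix x
    have "(\<Sum>n\<in>B. indicator A (T n x)) \<le> (\<Sum>n\<in>C. indicator A (T n x) :: real)"
      by (rule sum_mono2) (use that in auto)
    also note visits_upper
    finally show "(\<Sum>n\<in>B. indicator A (T n x)) \<le> visits A C" .
  qed
  show "visits A (B \<union> C) \<le> visits A B + visits A C" if "finite B" "finite C" for B C
  proof (rule visits_least)
    fix x
    have "(\<Sum>n\<in>B \<union> C. indicator A (T n x)) \<le>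
        (\<Sum>n\<in>B. indicator A (T n x)) + (\<Sum>n\<in>C. indicator A (T n x) :: real)"
      using that by (simp add: sum_Un sum_nonneg)
    also have "\<dots> \<le> visits A B + visits A C"
      by (intro add_mono visits_upper)
    finally show "(\<Sum>n\<in>B \<union> C. indicator A (T n x)) \<le> visits A B + visits A C" .
  qed
  show "visits A ((+) m ` B) \<le> visits A B" for B m
  proof (rule visits_least)
    fix x
    have "(\<Sum>n\<in>(+) m ` B. indicator A (T n x)) = (\<Sum>n\<in>B. indicator A (T n (T m x)) :: real)"
      by (subst sum.reindex) (auto simp: add.commute[of m] T_add)
    also note visits_upper
    finally show "(\<Sum>n\<in>(+) m ` B. indicator A (T n x)) \<le> visits A B" .
  qed
qed auto

text \<open>The limit is an infimum, so one good box for each \<open>\<delta>\<close> suffices; this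
  is what produces a countable intersection of open conditions.\<close>

lemma ocap_eq_zero_iff:
  "ocap T A = 0 \<longleftrightarrow> (\<forall>\<delta>>0. \<exists>N\<ge>1. visits A (box N) < \<delta> * real N ^ CARD('k))"
proof -
  let ?q = "\<lambda>N. visits A (box N) / real N ^ CARD('k)"
  have "ocap T A = (INF M\<in>{1..}. ?q M)"
    unfolding ocap_def using limI[OF visits_quotient_limit] by (simp add: visits_def)
  moreover have q0: "0 \<le> ?q M" for M by (simp add: visits_nonneg)
  then have bdd: "bdd_below (?q ` {1..})" by (intro bdd_belowI2[where m = 0])
  have ge: "0 \<le> (INF M\<in>{1..}. ?q M)" by (rule cINF_greatest) (use q0 in auto)
  have iff: "((INF M\<in>{1..}. ?q M) < \<delta>) \<longleftrightarrow> (\<exists>N\<ge>1. visits A (box N) < \<delta> * real N ^ CARD('k))" for \<delta>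
    by (subst cINF_less_iff[OF _ bdd]) (auto simp: pos_divide_less_eq intro!: bexI)
  have "(INF M\<in>{1..}. ?q M) = 0 \<longleftrightarrow> (\<forall>\<delta>>0. (INF M\<in>{1..}. ?q M) < \<delta>)"
    using ge by (auto simp: le_less intro: field_lbound_gt_zero dest: spec[where x = "INF M\<in>{1..}. ?q M"])
  ultimately show ?thesis by (simp only: iff)
qed

end

section \<open>Products of simplicial complexes\<close>

text \<open>The monotone coupling of two probability vectors: the overlap of the \<open>i\<close>-th and the \<open>j\<close>-th interval
  of the partitions of the unit interval that they define. Its support is a staircase, hence
  has at most \<open>a + b - 1\<close> points when those of \<open>p\<close> and \<open>q\<close> have \<open>a\<close> and \<open>b\<close> points.\<close>
definition coupling :: "(nat \<Rightarrow> real) \<Rightarrow> (nat \<Rightarrow> real) \<Rightarrow> nat \<Rightarrow> nat \<Rightarrow> real"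
  where "coupling p q i j =
    max 0 (min (sum p {..<Suc i}) (sum q {..<Suc j}) - max (sum p {..<i}) (sum q {..<j}))"

lemma coupling_nonneg: "0 \<le> coupling p q i j"
  by (simp add: coupling_def)

lemma coupling_commute: "coupling p q i j = coupling q p j i"
  by (simp add: coupling_def min.commute max.commute)

lemma sum_coupling:
  assumes "\<And>i. 0 \<le> p i" "\<And>j. 0 \<le> q j" "sum q {..<J} = 1" "sum p {..<Suc i} \<le> 1"
  shows "(\<Sum>j<J. coupling p q i j) = p i"
proof -
  define a b where "a = sum p {..<i}" and "b = sum p {..<Suc i}"
  \<comment> \<open>Clamping to the \<open>i\<close>-th interval of \<open>p\<close>: each overlap
    is a difference of clamped endpoints, so the sum telescopes.\<close>
  define cl where "cl t = max a (min b t)" for t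
  have ab: "0 \<le> a" "a \<le> b" "b \<le> 1" using assms by (auto simp: a_def b_def intro: sum_nonneg)
  have "coupling p q i j = cl (sum q {..<Suc j}) - cl (sum q {..<j})" for j
  proof -
    have "sum q {..<j} \<le> sum q {..<Suc j}" using assms by simp
    with ab show ?thesis unfolding coupling_def cl_def a_def[symmetric] b_def[symmetric]
      by (auto simp: max_def min_def)
  qed
  then have "(\<Sum>j<J. coupling p q i j) = cl (sum q {..<J}) - cl (sum q {..<0})"
    by (simp add: sum_lessThan_telescope[of "\<lambda>j. cl (sum q {..<j})"] del: sum.lessThan_Suc)
  also have "\<dots> = p i" using ab assms(3) by (simp add: cl_def) (simp add: a_def b_def)
  finally show ?thesis .
qed

text \<open>Otherwise interval \<open>i\<close> lies to the left of \<open>i'\<close> while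
  \<open>j'\<close> lies to the left of \<open>j\<close>, and the two overlaps would have to
  cross.\<close>

lemma coupling_monotone:
  assumes "\<And>i. 0 \<le> p i" "\<And>j. 0 \<le> q j"
    and "coupling p q i j \<noteq> 0" "coupling p q i' j' \<noteq> 0" "i < i'"
  shows "j \<le> j'"
proof (rule ccontr)
  assume "\<not> j \<le> j'"
  then have "sum q {..<Suc j'} \<le> sum q {..<j}" "sum p {..<Suc i} \<le> sum p {..<i'}"
    using assms by (auto intro!: sum_mono2 simp del: sum.lessThan_Suc)
  moreover have "sum q {..<j} < sum p {..<Suc i}" "sum p {..<i'} < sum q {..<Suc j'}"
    using assms(3,4) by (auto simp: coupling_def max_def split: if_splits)
  ultimately show False by linarith
qed

lemma coupling_support:
  assumes "\<And>i. 0 \<le> p i" "\<And>j. 0 \<le> q j" "coupling p q i j \<noteq> 0"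
  shows "p i \<noteq> 0" "q j \<noteq> 0"
  using assms(3) by (auto simp: coupling_def)

text \<open>These are the chains of the product order; the condition with the coordinates exchanged
  is the contrapositive.\<close>

definition staircase :: "(nat \<times> nat) set \<Rightarrow> bool"
  where "staircase C \<longleftrightarrow> (\<forall>i j i' j'. (i, j) \<in> C \<longrightarrow> (i', j') \<in> C \<longrightarrow> i < i' \<longrightarrow> j \<le> j')"

text \<open>Along a staircase the sum of the ranks of the two coordinates is strictly increasing.\<close>
lemma card_staircase:
  assumes "finite C" "C \<noteq> {}" "staircase C"
  shows "card C + 1 \<le> card (fst ` C) + card (snd ` C)"
proof -
  let ?A = "fst ` C" and ?B = "snd ` C"
  define r where "r A i = card {j \<in> A. j < i}" for A :: "nat set" and i
  have fin: "finite ?A" "finite ?B" using assms by auto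
  have r_less: "r A i < r A j" if "finite A" "i \<in> A" "i < j" for A i j
    unfolding r_def using that by (intro psubset_card_mono) auto
  have r_le: "r A i \<le> r A j" if "finite A" "i \<le> j" for A i j
    unfolding r_def using that by (intro card_mono) auto
  have r_card: "r A i < card A" if "finite A" "i \<in> A" for A i
    unfolding r_def using that by (intro psubset_card_mono) auto
  have less: "r ?A i + r ?B j < r ?A i' + r ?B j'"
    if "(i, j) \<in> C" "(i', j') \<in> C" "i < i' \<or> i = i' \<and> j < j'" for i j i' j'
  proof (cases "i < i'")
    case True
    then have "j \<le> j'" using assms(3) that unfolding staircase_def by blast
    moreover have "i \<in> ?A" using that by force
    ultimately show ?thesis using True r_less[OF fin(1)] r_le[OF fin(2)] by (simp add: add_less_le_mono)
  next
    case False
    moreover have "j \<in> ?B" using that by force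
    ultimately show ?thesis using that r_less[OF fin(2)] by auto
  qed
  have "inj_on (\<lambda>(i, j). r ?A i + r ?B j) C"
  proof (rule inj_onI, clarify)
    fix i j i' j' assume *: "(i, j) \<in> C" "(i', j') \<in> C" "r ?A i + r ?B j = r ?A i' + r ?B j'"
    then show "i = i' \<and> j = j'"
      using less[of i j i' j'] less[of i' j' i j] by (metis less_irrefl linorder_less_linear)
  qed
  \<comment> \<open>Ranks start at 0, so their sum is at most \<open>card ?A + card ?B - 2\<close>,
    which leaves one value fewer than the two cardinalities together.\<close>
  moreover have "r ?A i + r ?B j < card ?A + card ?B - 1" if "(i, j) \<in> C" for i j
  proof -
    have "i \<in> ?A" "j \<in> ?B" using that by force+
    then show ?thesis
      using r_card[OF fin(1), of i] r_card[OF fin(2), of j] by simp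
  qed
  then have "(\<lambda>(i, j). r ?A i + r ?B j) ` C \<subseteq> {..<card ?A + card ?B - 1}"
    by auto
  ultimately have "card C \<le> card ?A + card ?B - 1"
    using card_inj_on_le[of _ C "{..<card ?A + card ?B - 1}"] by simp
  moreover have "0 < card ?A" using fin assms by (simp add: card_gt_0_iff)
  ultimately show ?thesis by linarith
qed

section \<open>Complexes, barycentric coordinates and the product triangulation\<close>

lemma complex_dim_alt: "complex_dim K = Max (insert 0 ((\<lambda>\<sigma>. card \<sigma> - 1) ` K))"
proof -
  have "{card \<sigma> - 1 |\<sigma>. \<sigma> \<in> K} = (\<lambda>\<sigma>. card \<sigma> - 1) ` K" by blast
  then show ?thesis by (simp only: complex_dim_def insert_is_Un[symmetric])
qed

lemma card_le_complex_dim: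
  assumes "fin_simplicial_complex K" "\<sigma> \<in> K"
  shows "card \<sigma> \<le> complex_dim K + 1"
proof -
  have "finite K" using assms by (simp add: fin_simplicial_complex_def)
  then have "card \<sigma> - 1 \<le> complex_dim K"
    unfolding complex_dim_alt using assms(2) by (intro Max_ge finite.insertI finite_imageI insertI2 imageI)
  then show ?thesis by linarith
qed

lemma complex_dim_leI:
  assumes "finite K" "\<And>\<sigma>. \<sigma> \<in> K \<Longrightarrow> card \<sigma> \<le> m + 1"
  shows "complex_dim K \<le> m"
  unfolding complex_dim_alt
proof (rule Max.boundedI)
  fix a assume "a \<in> insert 0 ((\<lambda>\<sigma>. card \<sigma> - 1) ` K)"
  then show "a \<le> m" using assms(2) by (fastforce simp: le_diff_conv)
qed (use assms(1) in auto)

lemma fin_simplicial_complex_finite_Union: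
  "fin_simplicial_complex K \<Longrightarrow> finite (\<Union>K)"
  unfolding fin_simplicial_complex_def by (intro finite_Union) blast+

lemma fin_simplicial_complex_face:
  "fin_simplicial_complex K \<Longrightarrow> \<sigma> \<in> K \<Longrightarrow> \<tau> \<subseteq> \<sigma> \<Longrightarrow> \<tau> \<noteq> {} \<Longrightarrow> \<tau> \<in> K"
  unfolding fin_simplicial_complex_def by blast

lemma fin_simplicial_complexD:
  assumes "fin_simplicial_complex K"
  shows "finite K" "\<sigma> \<in> K \<Longrightarrow> finite \<sigma>" "\<sigma> \<in> K \<Longrightarrow> \<sigma> \<noteq> {}"
  using assms unfolding fin_simplicial_complex_def by blast+

lemma realizationD:
  assumes "p \<in> realization K"
  shows "0 \<le> p i" "{i. p i \<noteq> 0} \<in> K" "sum p {i. p i \<noteq> 0} = 1"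
  using assms by (auto simp: realization_def)

lemma realization_sum:
  assumes "p \<in> realization K" "\<Union>K \<subseteq> {..<I}"
  shows "sum p {..<I} = 1"
proof -
  have "sum p {i. p i \<noteq> 0} = sum p {..<I}"
    using realizationD(2)[OF assms(1)] assms(2) by (intro sum.mono_neutral_left) auto
  then show ?thesis using realizationD(3)[OF assms(1)] by simp
qed

lemma realization_sum_le:
  assumes "p \<in> realization K" "fin_simplicial_complex K"
  shows "sum p {..<i} \<le> 1"
proof -
  obtain I where I: "\<Union>K \<subseteq> {..<I}"
    using fin_simplicial_complex_finite_Union[OF assms(2)] by (auto simp: finite_nat_iff_bounded)
  then have "\<Union>K \<subseteq> {..<max i I}" by auto
  then have "sum p {..<max i I} = 1" by (rule realization_sum[OF assms(1)])
  moreover have "sum p {..<i} \<le> sum p {..<max i I}"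
    using realizationD(1)[OF assms(1)] by (intro sum_mono2) auto
  ultimately show ?thesis by simp
qed

text \<open>The staircase triangulation of a product with respect to the order of the vertices in
  \<open>nat\<close>. Vertices must again be numbers, hence \<open>prod_encode\<close>.\<close>

definition product_complex :: "nat set set \<Rightarrow> nat set set \<Rightarrow> nat set set"
  where "product_complex K L = {prod_encode ` C |C. staircase C \<and> fst ` C \<in> K \<and> snd ` C \<in> L}"

definition product_point :: "(nat \<Rightarrow> real) \<Rightarrow> (nat \<Rightarrow> real) \<Rightarrow> nat \<Rightarrow> real"
  where "product_point p q v = coupling p q (fst (prod_decode v)) (snd (prod_decode v))"

lemma fin_simplicial_complex_product:
  assumes K: "fin_simplicial_complex K" and L: "fin_simplicial_complex L"
  shows "fin_simplicial_complex (product_complex K L)"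
  unfolding fin_simplicial_complex_def
proof (intro conjI ballI allI impI)
  have "product_complex K L \<subseteq> Pow (prod_encode ` (\<Union>K \<times> \<Union>L))"
  proof
    fix \<sigma> assume "\<sigma> \<in> product_complex K L"
    then obtain C where C: "\<sigma> = prod_encode ` C" "fst ` C \<in> K" "snd ` C \<in> L"
      by (auto simp: product_complex_def)
    have "C \<subseteq> fst ` C \<times> snd ` C" by force
    also have "\<dots> \<subseteq> \<Union>K \<times> \<Union>L" using C by (intro Sigma_mono) auto
    finally show "\<sigma> \<in> Pow (prod_encode ` (\<Union>K \<times> \<Union>L))"
      using C(1) by (auto intro!: image_mono)
  qed
  then show "finite (product_complex K L)"
    by (rule finite_subset)
      (simp add: finite_imageI finite_SigmaI fin_simplicial_complex_finite_Union[OF K] fin_simplicial_complex_finite_Union[OF L])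
next
  fix \<sigma> assume "\<sigma> \<in> product_complex K L"
  then obtain C where C: "\<sigma> = prod_encode ` C" "staircase C" "fst ` C \<in> K" "snd ` C \<in> L"
    by (auto simp: product_complex_def)
  have "C \<subseteq> fst ` C \<times> snd ` C" by force
  moreover have "finite (fst ` C)" "finite (snd ` C)" "fst ` C \<noteq> {}"
    using fin_simplicial_complexD(2)[OF K C(3)] fin_simplicial_complexD(2)[OF L C(4)]
      fin_simplicial_complexD(3)[OF K C(3)] by auto
  ultimately have "finite C" "C \<noteq> {}" by (auto intro: finite_subset[OF _ finite_cartesian_product])
  then show "finite \<sigma>" "\<sigma> \<noteq> {}" using C(1) by auto
  fix \<tau> assume "\<tau> \<subseteq> \<sigma> \<and> \<tau> \<noteq> {}"
  then obtain D where D: "\<tau> = prod_encode ` D" "D \<subseteq> C" "D \<noteq> {}"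
    using C(1) by (auto simp: subset_image_iff)
  then have "fst ` D \<subseteq> fst ` C" "snd ` D \<subseteq> snd ` C" by auto
  then have "fst ` D \<in> K" "snd ` D \<in> L"
    using fin_simplicial_complex_face[OF K C(3)] fin_simplicial_complex_face[OF L C(4)] D(3) by auto
  moreover have "staircase D" using C(2) D(2) unfolding staircase_def by blast
  ultimately show "\<tau> \<in> product_complex K L" using D by (auto simp: product_complex_def)
qed

text \<open>Simplices with \<open>a\<close> and \<open>b\<close> vertices admit chains of at most
  \<open>a + b - 1\<close> vertices, so dimensions add.\<close>

lemma complex_dim_product:
  assumes K: "fin_simplicial_complex K" and L: "fin_simplicial_complex L"
  shows "complex_dim (product_complex K L) \<le> complex_dim K + complex_dim L"
proof (rule complex_dim_leI)
  show "finite (product_complex K L)"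
    using fin_simplicial_complex_product[OF assms] by (rule fin_simplicial_complexD)
  fix \<sigma> assume \<sigma>: "\<sigma> \<in> product_complex K L"
  then obtain C where C: "\<sigma> = prod_encode ` C" "staircase C" "fst ` C \<in> K" "snd ` C \<in> L"
    by (auto simp: product_complex_def)
  have "finite \<sigma>" "\<sigma> \<noteq> {}"
    using fin_simplicial_complexD(2,3)[OF fin_simplicial_complex_product[OF assms] \<sigma>] by auto
  then have "finite C" "C \<noteq> {}"
    using C(1) finite_imageD[of prod_encode C] inj_prod_encode[of C] by auto
  then have "card C + 1 \<le> card (fst ` C) + card (snd ` C)"
    using C(2) by (rule card_staircase)
  moreover have "card \<sigma> = card C" using C(1) inj_prod_encode by (simp add: card_image)
  ultimately show "card \<sigma> \<le> complex_dim K + complex_dim L + 1"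
    using card_le_complex_dim[OF K C(3)] card_le_complex_dim[OF L C(4)] by linarith
qed

text \<open>Row and column sums of the coupling recover \<open>p\<close> and \<open>q\<close>, which
  makes \<open>product_point\<close> injective. The bounds \<open>I\<close> and \<open>J\<close>
  keep the sums finite.\<close>

lemma product_point_marginals:
  assumes K: "fin_simplicial_complex K" and L: "fin_simplicial_complex L"
    and I: "\<Union>K \<subseteq> {..<I}" "\<Union>L \<subseteq> {..<J}"
    and p: "p \<in> realization K" and q: "q \<in> realization L"
  shows "p i = (\<Sum>j<J. product_point p q (prod_encode (i, j)))"
    and "q j = (\<Sum>i<I. product_point p q (prod_encode (i, j)))"
proof -
  have "(\<Sum>j<J. coupling p q i j) = p i"
    by (rule sum_coupling[of p q, OF realizationD(1)[OF p] realizationD(1)[OF q] realization_sum[OF q I(2)]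
        realization_sum_le[OF p K]])
  then show "p i = (\<Sum>j<J. product_point p q (prod_encode (i, j)))"
    by (simp add: product_point_def)
  have "(\<Sum>i<I. coupling q p j i) = q j"
    by (rule sum_coupling[of q p, OF realizationD(1)[OF q] realizationD(1)[OF p] realization_sum[OF p I(1)]
        realization_sum_le[OF q L]])
  then show "q j = (\<Sum>i<I. product_point p q (prod_encode (i, j)))"
    by (simp add: product_point_def coupling_commute[of p])
qed

lemma product_point_inject:
  assumes K: "fin_simplicial_complex K" and L: "fin_simplicial_complex L"
    and "p \<in> realization K" "q \<in> realization L" "p' \<in> realization K" "q' \<in> realization L"
    and eq: "product_point p q = product_point p' q'"
  shows "p = p' \<and> q = q'"
proof -
  obtain I J where IJ: "\<Union>K \<subseteq> {..<I}" "\<Union>L \<subseteq> {..<J}"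
    using fin_simplicial_complex_finite_Union[OF K] fin_simplicial_complex_finite_Union[OF L]
    by (auto simp: finite_nat_iff_bounded)
  show ?thesis
    using product_point_marginals[OF K L IJ assms(3,4)] product_point_marginals[OF K L IJ assms(5,6)] eq
    by (simp add: fun_eq_iff)
qed

lemma product_point_in_realization:
  assumes K: "fin_simplicial_complex K" and L: "fin_simplicial_complex L"
    and p: "p \<in> realization K" and q: "q \<in> realization L"
  shows "product_point p q \<in> realization (product_complex K L)"
proof -
  obtain I J where IJ: "\<Union>K \<subseteq> {..<I}" "\<Union>L \<subseteq> {..<J}"
    using fin_simplicial_complex_finite_Union[OF K] fin_simplicial_complex_finite_Union[OF L]
    by (auto simp: finite_nat_iff_bounded)
  define C where "C = {(i, j). coupling p q i j \<noteq> 0}"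
  have supp: "{v. product_point p q v \<noteq> 0} = prod_encode ` C"
    unfolding product_point_def C_def by (force intro: image_eqI[where x = "prod_decode v" for v])
  have p0: "\<And>i. 0 \<le> p i" and q0: "\<And>i. 0 \<le> q i" using realizationD p q by auto
  have CD: "p i \<noteq> 0 \<and> q j \<noteq> 0" if "(i, j) \<in> C" for i j
    using coupling_support[of p q i j, OF p0 q0] that by (simp add: C_def)
  then have sub: "fst ` C \<subseteq> {i. p i \<noteq> 0}" "snd ` C \<subseteq> {j. q j \<noteq> 0}"
    by auto
  have CIJ: "C \<subseteq> {..<I} \<times> {..<J}"
  proof (rule subrelI)
    fix i j assume "(i, j) \<in> C"
    then have "i \<in> \<Union>K" "j \<in> \<Union>L"
      using CD realizationD(2)[OF p] realizationD(2)[OF q] by blast+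
    then show "(i, j) \<in> {..<I} \<times> {..<J}" using IJ by blast
  qed
  \<comment> \<open>\<open>realization\<close> sums over the support only. Extended by zeros to a
    rectangle, the sum can be evaluated through the marginals.\<close>
  have "sum (product_point p q) {v. product_point p q v \<noteq> 0} = (\<Sum>(i, j)\<in>C. coupling p q i j)"
    unfolding supp using inj_prod_encode
    by (subst sum.reindex) (auto simp: product_point_def case_prod_unfold)
  also have "\<dots> = (\<Sum>(i, j)\<in>{..<I} \<times> {..<J}. coupling p q i j)"
    using CIJ by (intro sum.mono_neutral_left) (auto simp: C_def)
  also have "\<dots> = (\<Sum>i<I. \<Sum>j<J. coupling p q i j)"
    by (simp add: sum.cartesian_product)
  also have "\<dots> = (\<Sum>i<I. p i)"
    using product_point_marginals(1)[OF K L IJ p q] by (simp add: product_point_def)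
  also have "\<dots> = 1" by (rule realization_sum[OF p IJ(1)])
  finally have sum1: "sum (product_point p q) {v. product_point p q v \<noteq> 0} = 1" .
  then have "C \<noteq> {}" unfolding supp by auto
  then have "fst ` C \<in> K" "snd ` C \<in> L"
    using fin_simplicial_complex_face[OF K realizationD(2)[OF p] sub(1)]
      fin_simplicial_complex_face[OF L realizationD(2)[OF q] sub(2)] by auto
  moreover have "staircase C"
    unfolding staircase_def C_def using coupling_monotone[of p q, OF p0 q0] by blast
  ultimately have "{v. product_point p q v \<noteq> 0} \<in> product_complex K L"
    unfolding supp product_complex_def by blast
  with sum1 show ?thesis
    by (simp add: realization_def product_point_def coupling_nonneg)
qed

lemma continuous_on_product_point:
  assumes "continuous_on S f" "continuous_on S g"
  shows "continuous_on S (\<lambda>x. product_point (f x) (g x))"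
proof (rule continuous_on_coordinatewise_then_product)
  have "continuous_on S (\<lambda>x. f x i)" "continuous_on S (\<lambda>x. g x i)" for i
    using assms by (auto intro: continuous_on_product_then_coordinatewise)
  then show "continuous_on S (\<lambda>x. product_point (f x) (g x) v)" for v
    unfolding product_point_def coupling_def by (intro continuous_intros)
qed

section \<open>Subadditivity of the width dimension\<close>

definition widim_map ::
  "real \<Rightarrow> ('a::topological_space \<Rightarrow> 'a \<Rightarrow> real) \<Rightarrow> nat set set \<Rightarrow> ('a \<Rightarrow> nat \<Rightarrow> real) \<Rightarrow> bool"
  where "widim_map \<epsilon> d K f \<longleftrightarrow> fin_simplicial_complex K \<and> continuous_on UNIV f \<and> range f \<subseteq> realization K \<and>
    (\<forall>p\<in>range f. (SUP xy\<in>(f -` {p}) \<times> (f -` {p}). d (fst xy) (snd xy)) < \<epsilon>)"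

lemma widim_eq: "widim \<epsilon> d = Inf {complex_dim K |K. \<exists>f. widim_map \<epsilon> d K f}"
  unfolding widim_def widim_map_def by (intro arg_cong[where f = Inf] Collect_cong) blast

lemma widim_le: "widim_map \<epsilon> d K f \<Longrightarrow> widim \<epsilon> d \<le> complex_dim K"
  unfolding widim_eq by (rule cInf_lower) auto

lemma widim_attained:
  assumes "widim_map \<epsilon> d K f"
  obtains L g where "widim_map \<epsilon> d L g" "complex_dim L = widim \<epsilon> d"
proof -
  have "complex_dim K \<in> {complex_dim K |K. \<exists>f. widim_map \<epsilon> d K f}"
    using assms by blast
  then have "widim \<epsilon> d \<in> {complex_dim K |K. \<exists>f. widim_map \<epsilon> d K f}"
    unfolding widim_eq by (intro Inf_nat_def1) blast
  then show ?thesis using that by auto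
qed

text \<open>The bound \<open>B\<close> makes the supremum over a fibre meaningful. A bound
  \<open>e < \<epsilon>\<close> on the fibre then replaces it, and passes easily from one
  pseudometric to another.\<close>

lemma widim_map_iff:
  assumes bound: "\<And>x y. d x y \<le> B"
  shows "widim_map \<epsilon> d K f \<longleftrightarrow>
    fin_simplicial_complex K \<and> continuous_on UNIV f \<and> range f \<subseteq> realization K \<and>
    (\<forall>z. \<exists>e<\<epsilon>. \<forall>x y. f x = f z \<longrightarrow> f y = f z \<longrightarrow> d x y \<le> e)"
proof -
  have "(SUP xy\<in>(f -` {f z}) \<times> (f -` {f z}). d (fst xy) (snd xy)) < \<epsilon> \<longleftrightarrow>
      (\<exists>e<\<epsilon>. \<forall>x y. f x = f z \<longrightarrow> f y = f z \<longrightarrow> d x y \<le> e)" (is "?S < \<epsilon> \<longleftrightarrow> ?R") for z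
  proof
    assume less: "?S < \<epsilon>"
    have "d x y \<le> ?S" if "f x = f z" "f y = f z" for x y
    proof -
      have "d (fst (x, y)) (snd (x, y)) \<le> ?S"
        by (rule cSUP_upper) (use that bound in \<open>auto intro!: bdd_aboveI2\<close>)
      then show ?thesis by simp
    qed
    with less show ?R by blast
  next
    assume ?R
    then obtain e where e: "e < \<epsilon>" "\<And>x y. f x = f z \<Longrightarrow> f y = f z \<Longrightarrow> d x y \<le> e" by blast
    have "z \<in> f -` {f z}" by simp
    then have "?S \<le> e" by (intro cSUP_least) (use e(2) in auto)
    with e(1) show "?S < \<epsilon>" by simp
  qed
  then show ?thesis unfolding widim_map_def by auto
qed

lemma widim_map_mono:
  assumes "widim_map \<epsilon> d K f" "\<And>x y. d x y \<le> B" "\<And>x y. d' x y \<le> d x y" "\<epsilon> \<le> \<epsilon>'"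
  shows "widim_map \<epsilon>' d' K f"
proof -
  have bound: "d' x y \<le> B" for x y using assms(2)[of x y] assms(3)[of x y] by simp
  have "\<exists>e<\<epsilon>'. \<forall>x y. f x = f z \<longrightarrow> f y = f z \<longrightarrow> d' x y \<le> e" for z
  proof -
    obtain e where e: "e < \<epsilon>" "\<And>x y. f x = f z \<Longrightarrow> f y = f z \<Longrightarrow> d x y \<le> e"
      using assms(1) unfolding widim_map_iff[of d, OF assms(2)] by blast
    have "d' x y \<le> e" if "f x = f z" "f y = f z" for x y
      using order_trans[OF assms(3) e(2)[OF that]] .
    with e(1) assms(4) show ?thesis by (intro exI[of _ e]) auto
  qed
  then show ?thesis
    using assms(1) unfolding widim_map_iff[of d, OF assms(2)] widim_map_iff[of d', OF bound] by blast
qed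

lemma widim_map_comp:
  assumes "widim_map \<epsilon> d K f" "\<And>x y. d x y \<le> B" "continuous_on UNIV h"
  shows "widim_map \<epsilon> (\<lambda>x y. d (h x) (h y)) K (\<lambda>x. f (h x))"
proof -
  note iff = widim_map_iff[of d, OF assms(2)] widim_map_iff[of "\<lambda>x y. d (h x) (h y)", OF assms(2)]
  have "continuous_on UNIV f" using assms(1) by (simp add: widim_map_def)
  then have "continuous_on UNIV (\<lambda>x. f (h x))"
    using continuous_on_compose2[OF _ assms(3)] by blast
  moreover have "range (\<lambda>x. f (h x)) \<subseteq> realization K" "fin_simplicial_complex K"
    using assms(1) by (auto simp: widim_map_def)
  moreover have "\<exists>e<\<epsilon>. \<forall>x y. f (h x) = f (h z) \<longrightarrow> f (h y) = f (h z) \<longrightarrow> d (h x) (h y) \<le> e" for z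
  proof -
    obtain e where "e < \<epsilon>" "\<And>x y. f x = f (h z) \<Longrightarrow> f y = f (h z) \<Longrightarrow> d x y \<le> e"
      using assms(1) unfolding iff(1) by blast
    then show ?thesis by (intro exI[of _ e]) simp
  qed
  ultimately show ?thesis unfolding iff(2) by simp
qed

text \<open>Since \<open>product_point\<close> is injective, a fibre of the new map is the
  intersection of a fibre of \<open>f\<close> and a fibre of \<open>g\<close>, where
  \<open>d\<close> and \<open>d'\<close> are both small.\<close>

lemma widim_map_product:
  assumes f: "widim_map \<epsilon> d K f" and g: "widim_map \<epsilon> d' L g"
    and bound: "\<And>x y. d x y \<le> B" "\<And>x y. d' x y \<le> B"
    and max: "\<And>x y. d'' x y \<le> max (d x y) (d' x y)"
  shows "widim_map \<epsilon> d'' (product_complex K L) (\<lambda>x. product_point (f x) (g x))"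
proof -
  have bound'': "d'' x y \<le> B" for x y using bound[of x y] max[of x y] by linarith
  have K: "fin_simplicial_complex K" "continuous_on UNIV f" "\<And>x. f x \<in> realization K"
    and L: "fin_simplicial_complex L" "continuous_on UNIV g" "\<And>x. g x \<in> realization L"
    using f g unfolding widim_map_def by auto
  have "\<exists>e<\<epsilon>. \<forall>x y. product_point (f x) (g x) = product_point (f z) (g z) \<longrightarrow>
      product_point (f y) (g y) = product_point (f z) (g z) \<longrightarrow> d'' x y \<le> e" for z
  proof -
    obtain a where a: "a < \<epsilon>" "\<And>x y. f x = f z \<Longrightarrow> f y = f z \<Longrightarrow> d x y \<le> a"
      using f unfolding widim_map_iff[of d, OF bound(1)] by blast
    obtain b where b: "b < \<epsilon>" "\<And>x y. g x = g z \<Longrightarrow> g y = g z \<Longrightarrow> d' x y \<le> b"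
      using g unfolding widim_map_iff[of d', OF bound(2)] by blast
    have eq: "f x = f z \<and> g x = g z" if "product_point (f x) (g x) = product_point (f z) (g z)" for x
      by (rule product_point_inject[OF K(1) L(1) K(3) L(3) K(3) L(3) that])
    have "d'' x y \<le> max a b" if "product_point (f x) (g x) = product_point (f z) (g z)"
      "product_point (f y) (g y) = product_point (f z) (g z)" for x y
      using eq[OF that(1)] eq[OF that(2)] a(2)[of x y] b(2)[of x y] max[of x y] by linarith
    then show ?thesis using a(1) b(1) by (intro exI[of _ "max a b"]) auto
  qed
  moreover have "range (\<lambda>x. product_point (f x) (g x)) \<subseteq> realization (product_complex K L)"
    using product_point_in_realization K L by blast
  ultimately show ?thesis
    unfolding widim_map_iff[of d'', OF bound'']
    using fin_simplicial_complex_product[OF K(1) L(1)] continuous_on_product_point[OF K(2) L(2)]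
    by blast
qed

section \<open>Width dimension of orbit segments\<close>

context zk_action
begin

lemma dist_le_diameter: "dist (x::'a) y \<le> diameter (UNIV :: 'a set)"
  using compact_imp_bounded[OF compact_space] by (intro diameter_bounded_bound) auto

lemma dyn_dist_upper:
  "n \<in> \<Omega> \<Longrightarrow> dist (T n x) (T n y) \<le> dyn_dist T \<Omega> x y"
  unfolding dyn_dist_def by (rule cSUP_upper) (auto intro!: bdd_aboveI2 dist_le_diameter)

lemma dyn_dist_least:
  "\<Omega> \<noteq> {} \<Longrightarrow> (\<And>n. n \<in> \<Omega> \<Longrightarrow> dist (T n x) (T n y) \<le> c) \<Longrightarrow> dyn_dist T \<Omega> x y \<le> c"
  unfolding dyn_dist_def by (rule cSUP_least)

lemma dyn_dist_le_diameter: "\<Omega> \<noteq> {} \<Longrightarrow> dyn_dist T \<Omega> x y \<le> diameter (UNIV :: 'a set)"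
  by (rule dyn_dist_least) (auto intro: dist_le_diameter)

lemma dyn_dist_singleton: "dyn_dist T {n} x y = dist (T n x) (T n y)"
  by (simp add: dyn_dist_def)

lemma dyn_dist_mono: "\<Omega> \<noteq> {} \<Longrightarrow> \<Omega> \<subseteq> \<Omega>' \<Longrightarrow> dyn_dist T \<Omega> x y \<le> dyn_dist T \<Omega>' x y"
  by (rule dyn_dist_least) (auto intro: dyn_dist_upper)

lemma dyn_dist_Un:
  assumes "\<Omega> \<noteq> {}"
  shows "dyn_dist T (\<Omega> \<union> \<Omega>') x y \<le> max (dyn_dist T \<Omega> x y) (dyn_dist T \<Omega>' x y)"
  by (rule dyn_dist_least) (use assms in \<open>auto simp: le_max_iff_disj intro: dyn_dist_upper\<close>)

lemma dyn_dist_translate: "dyn_dist T ((+) m ` \<Omega>) x y = dyn_dist T \<Omega> (T m x) (T m y)"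
  by (simp add: dyn_dist_def image_image add.commute[of m] T_add)

text \<open>Finitely many preimages under \<open>T n\<close> of balls of radius
  \<open>\<epsilon> / 3\<close> cover the space. A subordinate partition of unity gives barycentric
  coordinates in a full simplex, and points with equal coordinates share a ball.\<close>

lemma widim_map_singleton:
  assumes "0 < \<epsilon>"
  shows "\<exists>K f. widim_map \<epsilon> (dyn_dist T {n}) K f"
proof -
  have cont: "continuous_on UNIV (\<lambda>x. \<epsilon> / 3 - dist (T n c) (T n x))" for c
    by (intro continuous_intros continuous_T)
  have "open {x. 0 < \<epsilon> / 3 - dist (T n c) (T n x)}" for c
    by (rule open_Collect_less) (intro continuous_intros continuous_T)+
  moreover have "UNIV \<subseteq> (\<Union>c. {x. 0 < \<epsilon> / 3 - dist (T n c) (T n x)})"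
    using assms by (auto intro!: exI[of _ x for x])
  ultimately obtain D where D: "finite D" "UNIV \<subseteq> (\<Union>c\<in>D. {x. 0 < \<epsilon> / 3 - dist (T n c) (T n x)})"
    using compactE_image[OF compact_space, of UNIV "\<lambda>c. {x. 0 < \<epsilon> / 3 - dist (T n c) (T n x)}"]
    by (metis (no_types, lifting))
  obtain m and c :: "nat \<Rightarrow> 'a" where c: "D = c ` {i. i < m}"
    using finite_imp_nat_seg_image_inj_on[OF D(1)] by blast
  define \<phi> where "\<phi> i x = max 0 (\<epsilon> / 3 - dist (T n (c i)) (T n x))" for i x
  define f where "f x i = (if i < m then \<phi> i x / (\<Sum>j<m. \<phi> j x) else 0)" for x i
  define K where "K = Pow {..<m} - {{}}"
  have \<phi>0: "0 \<le> \<phi> i x" for i x by (simp add: \<phi>_def)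
  have cont\<phi>: "continuous_on UNIV (\<phi> i)" for i
    unfolding \<phi>_def by (intro continuous_intros continuous_T)
  have pos: "0 < (\<Sum>j<m. \<phi> j x)" for x
  proof -
    have "x \<in> (\<Union>c\<in>D. {x. 0 < \<epsilon> / 3 - dist (T n c) (T n x)})" using D(2) by blast
    then obtain i where "i < m" "0 < \<phi> i x" unfolding c \<phi>_def by fastforce
    then show ?thesis by (intro sum_pos2[where i = i]) (auto intro: \<phi>0)
  qed
  have f0: "0 \<le> f x i" for x i using pos[of x] \<phi>0[of i x] by (simp add: f_def)
  have sum_f: "(\<Sum>i<m. f x i) = 1" for x
    using pos[of x] by (simp add: f_def sum_divide_distrib[symmetric])
  have supp: "{i. f x i \<noteq> 0} \<subseteq> {..<m}" for x by (auto simp: f_def)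
  have "f x \<in> realization K" for x
  proof -
    have "(\<Sum>i | f x i \<noteq> 0. f x i) = (\<Sum>i<m. f x i)"
      using supp by (intro sum.mono_neutral_left) auto
    then have "(\<Sum>i | f x i \<noteq> 0. f x i) = 1" by (simp add: sum_f)
    moreover from this have "{i. f x i \<noteq> 0} \<noteq> {}" by (metis sum.empty zero_neq_one)
    ultimately show ?thesis using supp[of x] f0 by (simp add: realization_def K_def)
  qed
  moreover have "fin_simplicial_complex K"
    unfolding fin_simplicial_complex_def K_def by (auto intro: finite_subset)
  moreover have "continuous_on UNIV f"
  proof (rule continuous_on_coordinatewise_then_product)
    fix i
    show "continuous_on UNIV (\<lambda>x. f x i)"
    proof (cases "i < m")
      case True
      then show ?thesis unfolding f_def using pos
        by (auto intro!: continuous_intros cont\<phi> simp: less_imp_neq[THEN not_sym])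
    qed (simp add: f_def)
  qed
  moreover have "dyn_dist T {n} x y \<le> 2 * \<epsilon> / 3" if "f x = f z" "f y = f z" for x y z
  proof -
    obtain i where i: "f z i \<noteq> 0"
      using sum_f[of z] by (metis sum.neutral zero_neq_one)
    then have "f x i \<noteq> 0" "f y i \<noteq> 0" using that by auto
    then have "\<phi> i x \<noteq> 0" "\<phi> i y \<noteq> 0" by (auto simp: f_def split: if_splits)
    then have "dist (T n (c i)) (T n x) < \<epsilon> / 3" "dist (T n (c i)) (T n y) < \<epsilon> / 3"
      by (auto simp: \<phi>_def max_def split: if_splits)
    then show ?thesis
      unfolding dyn_dist_singleton using dist_triangle3[of "T n x" "T n y" "T n (c i)"] by linarith
  qed
  ultimately have "widim_map \<epsilon> (dyn_dist T {n}) K f"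
    unfolding widim_map_iff[of "dyn_dist T {n}", OF dyn_dist_le_diameter[of "{n}", simplified]]
    using assms by (auto intro!: exI[of _ "2 * \<epsilon> / 3"])
  then show ?thesis by blast
qed

lemma widim_map_Un:
  assumes "\<Omega> \<noteq> {}" "\<Omega>' \<noteq> {}" "widim_map \<epsilon> (dyn_dist T \<Omega>) K f" "widim_map \<epsilon> (dyn_dist T \<Omega>') L g"
  shows "widim_map \<epsilon> (dyn_dist T (\<Omega> \<union> \<Omega>')) (product_complex K L) (\<lambda>x. product_point (f x) (g x))"
  using assms(3,4)
  by (rule widim_map_product) (use assms(1,2) in \<open>auto intro: dyn_dist_le_diameter dyn_dist_Un\<close>)

text \<open>Without such a map \<open>widim\<close> would be the infimum of an empty set of
  naturals, a mere default value.\<close>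

lemma widim_map_exists:
  assumes "finite \<Omega>" "\<Omega> \<noteq> {}" "0 < \<epsilon>"
  shows "\<exists>K f. widim_map \<epsilon> (dyn_dist T \<Omega>) K f"
  using assms(1,2)
proof (induction rule: finite_ne_induct)
  case (singleton n)
  show ?case by (rule widim_map_singleton[OF assms(3)])
next
  case (insert n \<Omega>)
  then show ?case
    using widim_map_singleton[OF assms(3), of n] widim_map_Un[of "{n}" \<Omega>] by fastforce
qed

lemma widim_map_optimal:
  assumes "finite \<Omega>" "\<Omega> \<noteq> {}" "0 < \<epsilon>"
  obtains K f where "widim_map \<epsilon> (dyn_dist T \<Omega>) K f" "complex_dim K = widim \<epsilon> (dyn_dist T \<Omega>)"
proof -
  obtain K f where "widim_map \<epsilon> (dyn_dist T \<Omega>) K f" using widim_map_exists[OF assms] by blast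
  then show ?thesis by (rule widim_attained) (rule that)
qed

abbreviation box_widim :: "real \<Rightarrow> nat \<Rightarrow> nat"
  where "box_widim \<epsilon> N \<equiv> widim \<epsilon> (dyn_dist T (box N))"

text \<open>The hypotheses of \<open>box_subadditive\<close> come from reusing a map on fewer times,
  pairing two maps into the product complex, and composing with \<open>T m\<close>.\<close>

lemma widim_quotient_limit:
  assumes "0 < \<epsilon>"
  shows "(\<lambda>N. real (box_widim \<epsilon> N) / real N ^ CARD('k)) \<longlonglongrightarrow>
    (INF M\<in>{1..}. real (box_widim \<epsilon> M) / real M ^ CARD('k))"
proof (rule quotient_limit[OF of_nat_0_le_iff], rule box_subadditive)
  show "real (widim \<epsilon> (dyn_dist T A)) \<le> real (widim \<epsilon> (dyn_dist T B))"
    if B: "finite B" "A \<noteq> {}" "A \<subseteq> B" for A B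
  proof -
    have "B \<noteq> {}" using B by auto
    then obtain K f where K: "widim_map \<epsilon> (dyn_dist T B) K f" "complex_dim K = widim \<epsilon> (dyn_dist T B)"
      using widim_map_optimal[OF B(1) _ assms] by blast
    have "widim_map \<epsilon> (dyn_dist T A) K f"
      by (rule widim_map_mono[OF K(1) dyn_dist_le_diameter[OF \<open>B \<noteq> {}\<close>] dyn_dist_mono[OF B(2,3)] order_refl])
    then show ?thesis using widim_le[of \<epsilon> _ K] K(2) by simp
  qed
  show "real (widim \<epsilon> (dyn_dist T (A \<union> B))) \<le> real (widim \<epsilon> (dyn_dist T A)) + real (widim \<epsilon> (dyn_dist T B))"
    if A: "finite A" "finite B" "A \<noteq> {}" "B \<noteq> {}" for A B
  proof -
    obtain K f where K: "widim_map \<epsilon> (dyn_dist T A) K f" "complex_dim K = widim \<epsilon> (dyn_dist T A)"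
      using widim_map_optimal[OF A(1,3) assms] by blast
    obtain L g where L: "widim_map \<epsilon> (dyn_dist T B) L g" "complex_dim L = widim \<epsilon> (dyn_dist T B)"
      using widim_map_optimal[OF A(2,4) assms] by blast
    have "widim \<epsilon> (dyn_dist T (A \<union> B)) \<le> complex_dim (product_complex K L)"
      by (rule widim_le[OF widim_map_Un[OF A(3,4) K(1) L(1)]])
    also have "\<dots> \<le> complex_dim K + complex_dim L"
      using K(1) L(1) by (intro complex_dim_product) (auto simp: widim_map_def)
    finally show ?thesis using K(2) L(2) by simp
  qed
  show "real (widim \<epsilon> (dyn_dist T ((+) m ` A))) \<le> real (widim \<epsilon> (dyn_dist T A))"
    if A: "finite A" "A \<noteq> {}" for A m
  proof -
    obtain K f where K: "widim_map \<epsilon> (dyn_dist T A) K f" "complex_dim K = widim \<epsilon> (dyn_dist T A)"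
      using widim_map_optimal[OF A assms] by blast
    have "widim_map \<epsilon> (dyn_dist T ((+) m ` A)) K (\<lambda>x. f (T m x))"
      unfolding dyn_dist_translate[abs_def]
      by (rule widim_map_comp[OF K(1) dyn_dist_le_diameter[OF A(2)] continuous_T])
    then show ?thesis using widim_le[of \<epsilon> _ K] K(2) by simp
  qed
qed auto

text \<open>\<open>Lim\<close> and \<open>lim\<close> denote something even without convergence, so
  convergence is proved first. The inner limits grow as \<open>\<epsilon>\<close> decreases, so the
  outer limit is their supremum, and a supremum of 0 makes each of them vanish.\<close>

lemma mdim_zero_widim:
  assumes "mdim T = 0" "0 < \<epsilon>"
  shows "(\<lambda>N. real (box_widim \<epsilon> N) / real N ^ CARD('k)) \<longlonglongrightarrow> 0"
proof -
  define q where "q e N = real (box_widim e N) / real N ^ CARD('k)" for e N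
  define g where "g e = (INF M\<in>{1..}. q e M)" for e
  have lim: "q e \<longlonglongrightarrow> g e" if "0 < e" for e
    using widim_quotient_limit[OF that] by (simp add: q_def[abs_def] g_def)
  have bdd: "bdd_below (q e ` {1..})" for e
    by (rule bdd_belowI2[where m = 0]) (simp add: q_def)
  have g0: "0 \<le> g e" for e unfolding g_def by (rule cINF_greatest) (auto simp: q_def)
  have anti: "g e' \<le> g e" if e: "0 < e" "e \<le> e'" for e e'
    unfolding g_def
  proof (rule cINF_mono[OF _ bdd])
    fix M :: nat assume "M \<in> {1..}"
    then have ne: "(box M :: (int ^ 'k) set) \<noteq> {}" by (simp add: box_eq_empty_iff)
    obtain K f where K: "widim_map e (dyn_dist T (box M)) K f" "complex_dim K = box_widim e M"
      using widim_map_optimal[OF finite_box ne e(1)] by blast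
    have "widim_map e' (dyn_dist T (box M)) K f"
      by (rule widim_map_mono[OF K(1) dyn_dist_le_diameter[OF ne] order_refl e(2)])
    then have "box_widim e' M \<le> box_widim e M" using widim_le[of e' _ K] K(2) by simp
    then have "q e' M \<le> q e M" by (simp add: q_def divide_right_mono)
    then show "\<exists>M'\<in>{1..}. q e' M' \<le> q e M" using \<open>M \<in> {1..}\<close> by blast
  qed simp
  define S where "S = (SUP e\<in>{0<..}. ereal (g e))"
  have "((\<lambda>e. ereal (g e)) \<longlongrightarrow> S) (at_right 0)"
  proof (rule order_tendstoI)
    fix a assume "a < S"
    then obtain e where e: "0 < e" "a < ereal (g e)" unfolding S_def less_SUP_iff by auto
    have "a < ereal (g e')" if "0 < e'" "e' < e" for e'
      using e(2) anti[OF that(1), of e] that(2) by (simp add: less_le_trans)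
    then show "\<forall>\<^sub>F e in at_right 0. a < ereal (g e)"
      unfolding eventually_at_right_field using e(1) by blast
  next
    fix a assume "S < a"
    have "ereal (g e) < a" if "0 < e" for e
      using \<open>S < a\<close> that unfolding S_def by (meson SUP_upper greaterThan_iff le_less_trans)
    then show "\<forall>\<^sub>F e in at_right 0. ereal (g e) < a"
      unfolding eventually_at_right_field by (intro exI[of _ 1]) auto
  qed
  moreover have "\<forall>\<^sub>F e in at_right 0. ereal (g e) = ereal (lim (q e))"
    unfolding eventually_at_right_field using limI[OF lim] by (intro exI[of _ 1]) auto
  ultimately have "((\<lambda>e. ereal (lim (q e))) \<longlongrightarrow> S) (at_right 0)"
    by (rule Lim_transform_eventually)
  then have "Lim (at_right 0) (\<lambda>e. ereal (lim (q e))) = S"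
    by (rule tendsto_Lim[rotated]) simp
  then have "S = 0" using assms(1) by (simp add: mdim_def q_def[abs_def])
  then have "ereal (g \<epsilon>) \<le> 0" using assms(2) unfolding S_def by (metis SUP_upper greaterThan_iff)
  then have "g \<epsilon> = 0" using g0[of \<epsilon>] by simp
  then show ?thesis using lim[OF assms(2)] by (simp add: q_def[abs_def])
qed

end

section \<open>Generic perturbation over a complex\<close>

text \<open>Union bound over labels \<open>l\<close> and sets \<open>S\<close> of
  \<open>m + 1\<close> indices. For given \<open>l\<close> and \<open>i\<close> at most two shifts
  produce a zero, so a pair \<open>l\<close>, \<open>S\<close> spoils at most
  \<open>2 ^ (m + 1) * Q ^ (card I - (m + 1))\<close> of the \<open>Q ^ card I\<close> choices, and
  there are at most \<open>card L * 2 ^ card I\<close> pairs.\<close>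

lemma avoid_zeros:
  fixes G :: "'i \<Rightarrow> 'a \<Rightarrow> real" and label :: "'a \<Rightarrow> 'l"
  assumes "finite I" "finite L" "\<And>x. label x \<in> L" "0 < \<epsilon>" "0 < Q"
    and close: "\<And>i x y. i \<in> I \<Longrightarrow> label x = label y \<Longrightarrow> \<bar>G i x - G i y\<bar> \<le> \<epsilon> / real Q"
    and few: "card L * 2 ^ (card I + m + 1) < Q ^ (m + 1)"
  obtains c :: "'i \<Rightarrow> nat" where "\<And>i. i \<in> I \<Longrightarrow> c i < Q"
    and "\<And>x. card {i \<in> I. G i x + \<epsilon> * real (c i) / real Q = 0} \<le> m"
proof -
  define Z where "Z l i = {q. q < Q \<and> (\<exists>x. label x = l \<and> G i x + \<epsilon> * real q / real Q = 0)}" for l i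
  have card_Z: "card (Z l i) \<le> 2" if "i \<in> I" for l i
  proof (cases "Z l i = {}")
    case False
    \<comment> \<open>On one label \<open>G i\<close> varies by at most
      \<open>\<epsilon> / Q\<close>, the distance between consecutive shifts.\<close>
    have near: "q' \<le> q + 1" if q: "q \<in> Z l i" "q' \<in> Z l i" for q q'
    proof -
      obtain x y where "label x = label y" "G i x + \<epsilon> * real q / real Q = 0" "G i y + \<epsilon> * real q' / real Q = 0"
        using q unfolding Z_def mem_Collect_eq by metis
      then have "\<epsilon> * real q' / real Q - \<epsilon> * real q / real Q \<le> \<epsilon> / real Q"
        using close[OF \<open>i \<in> I\<close>, of x y] by linarith
      then have "(\<epsilon> * real q' - \<epsilon> * real q) / real Q \<le> \<epsilon> / real Q"
        by (simp only: diff_divide_distrib)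
      then have "\<epsilon> * (real q' - real q) \<le> \<epsilon> * 1"
        using \<open>0 < Q\<close> by (simp add: divide_le_cancel right_diff_distrib)
      then show ?thesis using \<open>0 < \<epsilon>\<close> by simp
    qed
    have fin: "finite (Z l i)" unfolding Z_def by simp
    have "Z l i \<subseteq> {Min (Z l i), Min (Z l i) + 1}"
    proof
      fix q assume "q \<in> Z l i"
      then show "q \<in> {Min (Z l i), Min (Z l i) + 1}"
        using near[OF Min_in[OF fin False], of q] Min_le[OF fin, of q] by auto
    qed
    then have "card (Z l i) \<le> card {Min (Z l i), Min (Z l i) + 1}" by (rule card_mono[rotated]) simp
    then show ?thesis by simp
  qed simp
  define P where "P = {S. S \<subseteq> I \<and> card S = m + 1}"
  define W where "W l S = PiE I (\<lambda>i. if i \<in> S then Z l i else {..<Q})" for l S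
  have fin_P: "finite P" using \<open>finite I\<close> by (auto simp: P_def)
  have card_P: "card P \<le> 2 ^ card I"
  proof -
    have "card P \<le> card (Pow I)" using \<open>finite I\<close> by (intro card_mono) (auto simp: P_def)
    then show ?thesis using \<open>finite I\<close> by (simp add: card_Pow)
  qed
  have fin_W: "finite (W l S)" for l S
    unfolding W_def using \<open>finite I\<close> by (intro finite_PiE) (auto simp: Z_def)
  have card_W: "card (W l S) \<le> 2 ^ (m + 1) * Q ^ (card I - (m + 1))" if "S \<in> P" for l S
  proof -
    have S: "S \<subseteq> I" "card S = m + 1" using that by (auto simp: P_def)
    have "card (W l S) = (\<Prod>i\<in>I. card (if i \<in> S then Z l i else {..<Q}))"
      unfolding W_def using \<open>finite I\<close> by (simp add: card_PiE)
    also have "\<dots> \<le> (\<Prod>i\<in>I. if i \<in> S then 2 else Q)"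
      by (rule prod_mono) (auto intro: card_Z)
    also have "\<dots> = (\<Prod>i\<in>S. 2) * (\<Prod>i\<in>I - S. Q)"
      using prod.If_cases[OF \<open>finite I\<close>, of "\<lambda>i. i \<in> S" "\<lambda>_. 2" "\<lambda>_. Q"] S
      by (simp add: Int_absorb1 Diff_eq)
    also have "\<dots> = 2 ^ (m + 1) * Q ^ (card I - (m + 1))"
      using S \<open>finite I\<close> by (simp add: card_Diff_subset finite_subset)
    finally show ?thesis .
  qed
  have "\<not> PiE I (\<lambda>_. {..<Q}) \<subseteq> (\<Union>l\<in>L. \<Union>S\<in>P. W l S)"
  proof
    assume sub: "PiE I (\<lambda>_. {..<Q}) \<subseteq> (\<Union>l\<in>L. \<Union>S\<in>P. W l S)"
    have "Q ^ card I = card (PiE I (\<lambda>_. {..<Q}))"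
      using \<open>finite I\<close> by (simp add: card_PiE)
    also have "\<dots> \<le> card (\<Union>l\<in>L. \<Union>S\<in>P. W l S)"
      using sub \<open>finite L\<close> fin_P fin_W by (intro card_mono) auto
    also have "\<dots> \<le> (\<Sum>l\<in>L. card (\<Union>S\<in>P. W l S))"
      by (rule card_UN_le[OF \<open>finite L\<close>])
    also have "\<dots> \<le> (\<Sum>l\<in>L. \<Sum>S\<in>P. card (W l S))"
      by (intro sum_mono card_UN_le fin_P)
    also have "\<dots> \<le> (\<Sum>l\<in>L. \<Sum>S\<in>P. 2 ^ (m + 1) * Q ^ (card I - (m + 1)))"
      by (intro sum_mono card_W)
    also have "\<dots> = card L * (card P * (2 ^ (m + 1) * Q ^ (card I - (m + 1))))"
      by simp
    finally have le: "Q ^ card I \<le> card L * (card P * (2 ^ (m + 1) * Q ^ (card I - (m + 1))))" .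
    show False
    \<comment> \<open>The natural subtraction \<open>card I - (m + 1)\<close> is a true one only if
      some set of \<open>m + 1\<close> indices exists; otherwise the right-hand side is 0.\<close>
    proof (cases "P = {}")
      case True
      then show False using le \<open>0 < Q\<close> by simp
    next
      case False
      then obtain S where "S \<subseteq> I" "card S = m + 1" by (auto simp: P_def)
      then have "m + 1 \<le> card I" using card_mono[OF \<open>finite I\<close>] by metis
      then have Q_eq: "Q ^ card I = Q ^ (m + 1) * Q ^ (card I - (m + 1))"
        by (metis le_add_diff_inverse power_add)
      note le
      also have "card L * (card P * (2 ^ (m + 1) * Q ^ (card I - (m + 1))))
          \<le> card L * (2 ^ card I * (2 ^ (m + 1) * Q ^ (card I - (m + 1))))"
        by (intro mult_le_mono card_P order_refl)
      also have "\<dots> = (card L * 2 ^ (card I + m + 1)) * Q ^ (card I - (m + 1))"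
        by (simp add: power_add ac_simps)
      finally have "Q ^ (m + 1) * Q ^ (card I - (m + 1))
          \<le> (card L * 2 ^ (card I + m + 1)) * Q ^ (card I - (m + 1))"
        using Q_eq by simp
      then show False using few \<open>0 < Q\<close> by simp
    qed
  qed
  then obtain c where c: "c \<in> PiE I (\<lambda>_. {..<Q})" "\<And>l S. l \<in> L \<Longrightarrow> S \<in> P \<Longrightarrow> c \<notin> W l S"
    by blast
  show ?thesis
  proof
    show "c i < Q" if "i \<in> I" for i using c(1) that by auto
    fix x
    let ?A = "{i \<in> I. G i x + \<epsilon> * real (c i) / real Q = 0}"
    show "card ?A \<le> m"
    proof (rule ccontr)
      assume "\<not> card ?A \<le> m"
      then have "m + 1 \<le> card ?A" by simp
      then obtain S where S: "S \<subseteq> ?A" "card S = m + 1"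
        by (meson obtain_subset_with_card_n)
      then have "S \<in> P" by (auto simp: P_def)
      moreover have "c \<in> W (label x) S"
        unfolding W_def using c(1) S(1) by (auto simp: PiE_iff Z_def)
      ultimately show False using c(2) assms(3) by blast
    qed
  qed
qed

text \<open>A point of a simplex is determined by all its barycentric coordinates but one, so that at
  resolution \<open>1 / k\<close> a simplex of dimension \<open>m\<close> needs only about \<open>k ^ m\<close> labels.\<close>
lemma realization_labels:
  assumes K: "fin_simplicial_complex K" and "0 < k"
  obtains L :: "(nat set \<times> (nat \<Rightarrow> nat)) set" and label where "finite L"
    and "card L \<le> card K * (k + 1) ^ complex_dim K"
    and "\<And>p. p \<in> realization K \<Longrightarrow> label p \<in> L"
    and "\<And>p q. p \<in> realization K \<Longrightarrow> q \<in> realization K \<Longrightarrow> label p = label q \<Longrightarrow>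
      (\<Sum>v\<in>\<Union>K. \<bar>p v - q v\<bar>) \<le> 2 * real (card (\<Union>K)) / real k"
proof
  \<comment> \<open>The least vertex of each simplex is the one whose coordinate is left
    out.\<close>
  define L where "L = (SIGMA \<sigma>:K. PiE (\<sigma> - {Min \<sigma>}) (\<lambda>_. {..k}))"
  define supp :: "(nat \<Rightarrow> real) \<Rightarrow> nat set" where "supp p = {v. p v \<noteq> 0}" for p
  define label where "label p = (supp p,
    restrict (\<lambda>v. nat \<lfloor>real k * p v\<rfloor>) (supp p - {Min (supp p)}))" for p
  have K': "finite K" "\<And>\<sigma>. \<sigma> \<in> K \<Longrightarrow> finite \<sigma>" "\<And>\<sigma>. \<sigma> \<in> K \<Longrightarrow> \<sigma> \<noteq> {}"
    using fin_simplicial_complexD[OF K] by auto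
  show "finite L" unfolding L_def using K' by (intro finite_SigmaI finite_PiE) auto
  have "card L = (\<Sum>\<sigma>\<in>K. card (PiE (\<sigma> - {Min \<sigma>}) (\<lambda>_. {..k})))"
    unfolding L_def using K' by (intro card_SigmaI) (auto intro!: finite_PiE)
  also have "\<dots> \<le> (\<Sum>\<sigma>\<in>K. (k + 1) ^ complex_dim K)"
  proof (rule sum_mono)
    fix \<sigma> assume \<sigma>: "\<sigma> \<in> K"
    have "card (PiE (\<sigma> - {Min \<sigma>}) (\<lambda>_. {..k})) = (k + 1) ^ (card \<sigma> - 1)"
      using K' \<sigma> by (simp add: card_PiE)
    also have "\<dots> \<le> (k + 1) ^ complex_dim K"
      using card_le_complex_dim[OF K \<sigma>] by (intro power_increasing) auto
    finally show "card (PiE (\<sigma> - {Min \<sigma>}) (\<lambda>_. {..k})) \<le> (k + 1) ^ complex_dim K" .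
  qed
  finally show "card L \<le> card K * (k + 1) ^ complex_dim K" by simp
  have supp_K: "supp p \<in> K" if "p \<in> realization K" for p
    using realizationD(2)[OF that] by (simp add: supp_def)
  show "label p \<in> L" if p: "p \<in> realization K" for p
  proof -
    have "p v \<le> 1" for v
    proof -
      have "p v \<le> sum p {..<Suc v}"
        using realizationD(1)[OF p] by (intro member_le_sum) auto
      also have "\<dots> \<le> 1" by (rule realization_sum_le[OF p K])
      finally show ?thesis .
    qed
    then have "real k * p v \<le> real k" for v by (simp add: mult_left_le)
    then have "nat \<lfloor>real k * p v\<rfloor> \<le> k" for v by (simp add: nat_le_iff floor_le_iff) (meson less_add_one le_less_trans)
    then show ?thesis using supp_K[OF p] by (auto simp: L_def label_def)
  qed
  fix p q assume p: "p \<in> realization K" and q: "q \<in> realization K" and eq: "label p = label q"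
  define \<sigma> where "\<sigma> = supp p"
  define v0 where "v0 = Min \<sigma>"
  have \<sigma>: "supp q = \<sigma>" "\<sigma> \<in> K" using eq supp_K[OF p] by (auto simp: label_def \<sigma>_def)
  have v0: "v0 \<in> \<sigma>" using K' \<sigma>(2) by (simp add: v0_def)
  have fin: "finite (\<Union>K)" by (rule fin_simplicial_complex_finite_Union[OF K])
  have fin\<sigma>: "finite \<sigma>" using K' \<sigma> by blast
  have diff: "\<bar>p v - q v\<bar> \<le> 1 / real k" if "v \<in> \<sigma> - {v0}" for v
  proof -
    have "snd (label p) v = snd (label q) v" using eq by simp
    then have "nat \<lfloor>real k * p v\<rfloor> = nat \<lfloor>real k * q v\<rfloor>"
      using that \<sigma>(1) by (simp add: label_def \<sigma>_def[symmetric] v0_def[symmetric])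
    moreover have "0 \<le> real k * p v" "0 \<le> real k * q v"
      using realizationD(1)[OF p] realizationD(1)[OF q] by auto
    ultimately have "\<lfloor>real k * p v\<rfloor> = \<lfloor>real k * q v\<rfloor>"
      by (simp add: eq_nat_nat_iff)
    then have "\<bar>real k * p v - real k * q v\<bar> \<le> 1" by linarith
    then have "real k * \<bar>p v - q v\<bar> \<le> 1" by (simp add: abs_mult right_diff_distrib[symmetric])
    then show ?thesis using \<open>0 < k\<close> by (simp add: field_simps)
  qed
  have sum_diff: "(\<Sum>v\<in>\<sigma> - {v0}. \<bar>p v - q v\<bar>) \<le> real (card (\<Union>K)) / real k"
  proof -
    have "(\<Sum>v\<in>\<sigma> - {v0}. \<bar>p v - q v\<bar>) \<le> (\<Sum>v\<in>\<sigma> - {v0}. 1 / real k)"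
      by (rule sum_mono[OF diff])
    also have "\<dots> = real (card (\<sigma> - {v0})) / real k" by simp
    also have "\<dots> \<le> real (card (\<Union>K)) / real k"
      using card_mono[OF fin, of "\<sigma> - {v0}"] \<sigma>(2) by (intro divide_right_mono) auto
    finally show ?thesis .
  qed
  \<comment> \<open>As both coordinate sums are 1, the error at the omitted vertex is at most the
    sum of the other errors; hence the factor 2.\<close>
  have "sum p \<sigma> = 1" "sum q \<sigma> = 1"
    using realizationD(3)[OF p] realizationD(3)[OF q] \<sigma>(1) by (auto simp: supp_def \<sigma>_def)
  then have "p v0 + sum p (\<sigma> - {v0}) = 1" "q v0 + sum q (\<sigma> - {v0}) = 1"
    using sum.remove[OF fin\<sigma> v0, of p] sum.remove[OF fin\<sigma> v0, of q] by auto
  then have "p v0 - q v0 = - (\<Sum>v\<in>\<sigma> - {v0}. p v - q v)"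
    by (simp add: sum_subtractf)
  then have v0_le: "\<bar>p v0 - q v0\<bar> \<le> (\<Sum>v\<in>\<sigma> - {v0}. \<bar>p v - q v\<bar>)"
    using sum_abs[of "\<lambda>v. p v - q v" "\<sigma> - {v0}"] by simp
  have "(\<Sum>v\<in>\<Union>K. \<bar>p v - q v\<bar>) = (\<Sum>v\<in>\<sigma>. \<bar>p v - q v\<bar>)"
  proof (rule sum.mono_neutral_right[OF fin])
    show "\<forall>v\<in>\<Union>K - \<sigma>. \<bar>p v - q v\<bar> = 0"
      using \<sigma>(1) by (auto simp: \<sigma>_def supp_def)
  qed (use \<sigma>(2) in blast)
  also have "\<dots> = \<bar>p v0 - q v0\<bar> + (\<Sum>v\<in>\<sigma> - {v0}. \<bar>p v - q v\<bar>)"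
    by (rule sum.remove[OF fin\<sigma> v0])
  also have "\<dots> \<le> 2 * real (card (\<Union>K)) / real k"
    using v0_le sum_diff by linarith
  finally show "(\<Sum>v\<in>\<Union>K. \<bar>p v - q v\<bar>) \<le> 2 * real (card (\<Union>K)) / real k" .
qed

text \<open>McShane's extension formula, applied to a function that is only approximately Lipschitz.\<close>
lemma lipschitz_approximation:
  fixes h :: "'a \<Rightarrow> real"
  assumes rho: "\<And>x. \<rho> x x = 0" "\<And>x y z. \<rho> x z \<le> \<rho> x y + \<rho> y z" "\<And>x y. 0 \<le> \<rho> x y"
    and "0 \<le> \<Lambda>" and bound: "\<And>x. h x \<le> B" and h: "\<And>x y. h y \<le> h x + \<epsilon> + \<Lambda> * \<rho> x y"
  obtains G where "\<And>x. \<bar>G x - h x\<bar> \<le> \<epsilon>" "\<And>x y. G x - G y \<le> \<Lambda> * \<rho> y x"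
proof
  define G where "G x = (SUP y. h y - \<Lambda> * \<rho> x y)" for x
  have upper: "h y - \<Lambda> * \<rho> x y \<le> G x" for x y
    unfolding G_def
  proof (rule cSUP_upper)
    have "h y - \<Lambda> * \<rho> x y \<le> B" for y
      using bound[of y] mult_nonneg_nonneg[OF \<open>0 \<le> \<Lambda>\<close> rho(3)[of x y]] by linarith
    then show "bdd_above (range (\<lambda>y. h y - \<Lambda> * \<rho> x y))" by (intro bdd_aboveI2)
  qed simp
  have least: "G x \<le> c" if "\<And>y. h y - \<Lambda> * \<rho> x y \<le> c" for x c
    unfolding G_def using that by (intro cSUP_least) auto
  show "\<bar>G x - h x\<bar> \<le> \<epsilon>" for x
  proof -
    have "h x \<le> G x" using upper[of x x] rho(1) by simp
    moreover have "G x \<le> h x + \<epsilon>" by (rule least) (use h in \<open>simp add: algebra_simps\<close>)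
    ultimately show ?thesis by simp
  qed
  show "G x - G y \<le> \<Lambda> * \<rho> y x" for x y
  proof -
    have "h z - \<Lambda> * \<rho> x z \<le> G y + \<Lambda> * \<rho> y x" for z
    proof -
      have "\<Lambda> * \<rho> y z \<le> \<Lambda> * (\<rho> y x + \<rho> x z)"
        by (rule mult_left_mono[OF rho(2) \<open>0 \<le> \<Lambda>\<close>])
      then show ?thesis using upper[of z y] by (simp add: algebra_simps)
    qed
    then have "G x \<le> G y + \<Lambda> * \<rho> y x" by (rule least)
    then show ?thesis by simp
  qed
qed

text \<open>The pairs on which \<open>h\<close> differs by at least \<open>\<epsilon>\<close> form a
  compact set where \<open>\<rho>\<close> has a positive minimum \<open>\<kappa>\<close>. There the
  slope \<open>2 * B / \<kappa>\<close> absorbs the whole oscillation of \<open>h\<close>; elsewhere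
  \<open>\<epsilon>\<close> does.\<close>

lemma approximately_lipschitz:
  fixes h :: "'a::metric_space \<Rightarrow> real"
  assumes "compact (UNIV :: 'a set)" "continuous_on UNIV h"
    and rho: "continuous_on UNIV (\<lambda>(x, y). \<rho> x y)" "\<And>x y. 0 \<le> \<rho> x y"
    and near: "\<And>x y. \<rho> x y = 0 \<Longrightarrow> \<bar>h x - h y\<bar> < \<epsilon>" and "0 < \<epsilon>"
  obtains \<Lambda> where "0 \<le> \<Lambda>" "\<And>x y. h y \<le> h x + \<epsilon> + \<Lambda> * \<rho> x y"
proof -
  have "bounded (range h)"
    using assms(1,2) by (intro compact_imp_bounded compact_continuous_image)
  then obtain B where B: "\<And>x. \<bar>h x\<bar> \<le> B" by (auto simp: bounded_iff)
  have "0 \<le> B" using B[of undefined] by linarith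
  define D :: "('a \<times> 'a) set" where "D = {z. \<epsilon> \<le> \<bar>h (fst z) - h (snd z)\<bar>}"
  have h': "continuous_on UNIV (\<lambda>z. h (fst z))" "continuous_on UNIV (\<lambda>z. h (snd z))"
    by (auto intro!: continuous_on_compose2[OF assms(2)] continuous_intros)
  have "closed D" unfolding D_def
    by (intro closed_Collect_le continuous_intros h')
  moreover have "compact (UNIV :: ('a \<times> 'a) set)"
    using compact_Times[OF assms(1,1)] by simp
  ultimately have "compact D" using closed_Int_compact[of D UNIV] by simp
  obtain \<kappa> where \<kappa>: "0 < \<kappa>" "\<And>x y. (x, y) \<in> D \<Longrightarrow> \<kappa> \<le> \<rho> x y"
  proof (cases "D = {}")
    case True
    then show ?thesis using that[of 1] by simp
  next
    case False
    obtain x0 y0 where x0: "(x0, y0) \<in> D" "\<And>x y. (x, y) \<in> D \<Longrightarrow> \<rho> x0 y0 \<le> \<rho> x y"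
      using continuous_attains_inf[OF \<open>compact D\<close> False continuous_on_subset[OF rho(1)]] by fastforce
    then have "\<rho> x0 y0 \<noteq> 0" using near[of x0 y0] by (auto simp: D_def)
    then show ?thesis using that[of "\<rho> x0 y0"] rho(2)[of x0 y0] x0(2) by simp
  qed
  show ?thesis
  proof (rule that[of "2 * B / \<kappa>"])
    show "0 \<le> 2 * B / \<kappa>" using \<open>0 \<le> B\<close> \<kappa>(1) by simp
    fix x y
    show "h y \<le> h x + \<epsilon> + 2 * B / \<kappa> * \<rho> x y"
    proof (cases "(x, y) \<in> D")
      case True
      have "2 * B = 2 * B / \<kappa> * \<kappa>" using \<kappa>(1) by simp
      also have "\<dots> \<le> 2 * B / \<kappa> * \<rho> x y"
        using \<kappa>(2)[OF True] \<open>0 \<le> B\<close> \<kappa>(1) by (intro mult_left_mono) auto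
      finally show ?thesis using B[of x] B[of y] \<open>0 < \<epsilon>\<close> by linarith
    next
      case False
      have "0 \<le> 2 * B / \<kappa> * \<rho> x y" using \<open>0 \<le> B\<close> \<kappa>(1) rho(2)[of x y] by simp
      then show ?thesis using False by (simp add: D_def)
    qed
  qed
qed

text \<open>The constants added to the coordinates are chosen by counting: a point of the complex is
  described at resolution \<open>1 / k\<close> by few labels, whereas \<open>m + 1\<close> prescribed zeros would cut down
  the choices by a larger factor when \<open>m\<close> is the dimension of the complex.\<close>
lemma generic_perturbation:
  fixes h :: "'i \<Rightarrow> 'a::metric_space \<Rightarrow> real"
  assumes "compact (UNIV :: 'a set)" "finite I" "\<And>i. i \<in> I \<Longrightarrow> continuous_on UNIV (h i)"
    and K: "fin_simplicial_complex K" and f: "continuous_on UNIV f" "\<And>x. f x \<in> realization K"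
    and near: "\<And>i x y. i \<in> I \<Longrightarrow> f x = f y \<Longrightarrow> \<bar>h i x - h i y\<bar> < \<epsilon>" and "0 < \<epsilon>"
  obtains F where "\<And>i. i \<in> I \<Longrightarrow> continuous_on UNIV (F i)"
    and "\<And>i x. i \<in> I \<Longrightarrow> \<bar>F i x - h i x\<bar> \<le> 2 * \<epsilon>"
    and "\<And>x. card {i \<in> I. F i x = 0} \<le> complex_dim K"
proof -
  \<comment> \<open>A pseudometric whose zero set consists of the pairs in a common fibre of
    \<open>f\<close>, exactly where \<open>near\<close> applies.\<close>
  define \<rho> where "\<rho> x y = (\<Sum>v\<in>\<Union>K. \<bar>f x v - f y v\<bar>)" for x y
  have fin: "finite (\<Union>K)" by (rule fin_simplicial_complex_finite_Union[OF K])
  have f_coord: "continuous_on UNIV (\<lambda>x. f x v)" for v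
    using f(1) by (rule continuous_on_product_then_coordinatewise)
  have rho: "\<rho> x x = 0" "\<rho> x z \<le> \<rho> x y + \<rho> y z" "0 \<le> \<rho> x y" for x y z
    unfolding \<rho>_def by (auto simp: sum.distrib[symmetric] intro!: sum_mono sum_nonneg)
  have f_outside: "f x v = 0" if "v \<notin> \<Union>K" for x v
    using realizationD(2)[OF f(2)[of x]] that by auto
  have rho0: "f x = f y" if "\<rho> x y = 0" for x y
  proof
    fix v
    have "\<forall>v\<in>\<Union>K. \<bar>f x v - f y v\<bar> = 0"
      using that fin unfolding \<rho>_def by (subst (asm) sum_nonneg_eq_0_iff) auto
    then show "f x v = f y v" using f_outside[of v] by (cases "v \<in> \<Union>K") auto
  qed
  have cont: "continuous_on UNIV (\<lambda>(x, y). \<rho> x y)"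
    unfolding \<rho>_def case_prod_unfold
    by (intro continuous_intros continuous_on_compose2[OF f_coord]) auto
  have cont1: "continuous_on UNIV (\<rho> x)" for x
    unfolding \<rho>_def by (intro continuous_intros f_coord)
  have "\<exists>\<Lambda> G. 0 \<le> \<Lambda> \<and> (\<forall>x. \<bar>G x - h i x\<bar> \<le> \<epsilon>) \<and> (\<forall>x y. G x - G y \<le> \<Lambda> * \<rho> y x)" if i: "i \<in> I" for i
  proof -
    obtain \<Lambda> where \<Lambda>: "0 \<le> \<Lambda>" "\<And>x y. h i y \<le> h i x + \<epsilon> + \<Lambda> * \<rho> x y"
      using approximately_lipschitz[OF assms(1) assms(3)[OF i] cont rho(3), of \<epsilon>] near[OF i] rho0 \<open>0 < \<epsilon>\<close> by blast
    have "bounded (range (h i))"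
      using assms(1) assms(3)[OF i] by (intro compact_imp_bounded compact_continuous_image)
    then obtain B where "\<And>x. h i x \<le> B" by (auto simp: bounded_iff abs_le_iff)
    then show ?thesis using lipschitz_approximation[of \<rho> \<Lambda> "h i" B \<epsilon>] rho \<Lambda> by metis
  qed
  then obtain \<Lambda> G where G: "\<And>i. i \<in> I \<Longrightarrow> 0 \<le> \<Lambda> i" "\<And>i x. i \<in> I \<Longrightarrow> \<bar>G i x - h i x\<bar> \<le> \<epsilon>"
    "\<And>i x y. i \<in> I \<Longrightarrow> G i x - G i y \<le> \<Lambda> i * \<rho> y x"
    by metis
  have sym: "\<rho> x y = \<rho> y x" for x y
    unfolding \<rho>_def by (simp add: abs_minus_commute)
  have G_abs: "\<bar>G i x - G i y\<bar> \<le> \<Lambda> i * \<rho> x y" if "i \<in> I" for i x y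
    using G(3)[OF that, of x y] G(3)[OF that, of y x] sym[of x y] by auto
  have contG: "continuous_on UNIV (G i)" if i: "i \<in> I" for i
    unfolding continuous_on_def
  proof
    fix x
    have "(\<rho> x \<longlongrightarrow> \<rho> x x) (at x)" using cont1[of x] by (simp add: continuous_on_def)
    then have "((\<lambda>y. \<Lambda> i * \<rho> x y) \<longlongrightarrow> 0) (at x)"
      by (auto intro!: tendsto_mult_right_zero simp: rho)
    then have "((\<lambda>y. G i y - G i x) \<longlongrightarrow> 0) (at x)"
      by (rule Lim_null_comparison[rotated]) (use G_abs[OF i] sym in \<open>auto intro!: always_eventually\<close>)
    then show "(G i \<longlongrightarrow> G i x) (at x within UNIV)" by (simp add: LIM_zero_cancel)
  qed
  define M where "M = (\<Sum>i\<in>I. \<Lambda> i)"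
  have M: "\<Lambda> i \<le> M" if "i \<in> I" for i
    unfolding M_def using that \<open>finite I\<close> G(1) by (intro member_le_sum) auto
  have "0 \<le> M" unfolding M_def using G(1) by (intro sum_nonneg)
  define m where "m = complex_dim K"
  \<comment> \<open>\<open>A\<close> is fixed by the Lipschitz constants alone, so that resolution
    \<open>1 / (Q * A)\<close> controls \<open>G\<close> up to \<open>\<epsilon> / Q\<close> for
    every \<open>Q\<close>. The number of labels is then at most a constant times
    \<open>Q ^ m\<close>, and \<open>Q\<close> is chosen to exceed that constant times the factor in
    \<open>few\<close>.\<close>
  define A where "A = nat \<lceil>2 * M * real (card (\<Union>K)) / \<epsilon>\<rceil> + 1"
  define Q where "Q = card K * (A + 1) ^ m * 2 ^ (card I + m + 1) + 1"
  have A: "2 * M * real (card (\<Union>K)) \<le> \<epsilon> * real A"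
  proof -
    have "2 * M * real (card (\<Union>K)) / \<epsilon> \<le> real A" unfolding A_def by linarith
    then show ?thesis using \<open>0 < \<epsilon>\<close> by (simp add: field_simps)
  qed
  have "0 < Q * A" by (simp add: Q_def A_def)
  obtain L :: "(nat set \<times> (nat \<Rightarrow> nat)) set" and label where L: "finite L"
    "card L \<le> card K * (Q * A + 1) ^ m" "\<And>p. p \<in> realization K \<Longrightarrow> label p \<in> L"
    "\<And>p q. p \<in> realization K \<Longrightarrow> q \<in> realization K \<Longrightarrow> label p = label q \<Longrightarrow>
      (\<Sum>v\<in>\<Union>K. \<bar>p v - q v\<bar>) \<le> 2 * real (card (\<Union>K)) / real (Q * A)"
    using realization_labels[OF K \<open>0 < Q * A\<close>] unfolding m_def by blast
  have close: "\<bar>G i x - G i y\<bar> \<le> \<epsilon> / real Q" if i: "i \<in> I" and eq: "label (f x) = label (f y)" for i x y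
  proof -
    have "\<bar>G i x - G i y\<bar> \<le> \<Lambda> i * \<rho> x y" by (rule G_abs[OF i])
    also have "\<dots> \<le> M * (2 * real (card (\<Union>K)) / real (Q * A))"
      using L(4)[OF f(2) f(2) eq] M[OF i] \<open>0 \<le> M\<close> rho(3) by (intro mult_mono) (auto simp: \<rho>_def)
    also have "\<dots> = (2 * M * real (card (\<Union>K))) / (real Q * real A)" by simp
    also have "\<dots> \<le> (\<epsilon> * real A) / (real Q * real A)"
      by (intro divide_right_mono A) simp
    also have "\<dots> = \<epsilon> / real Q" by (simp add: A_def)
    finally show ?thesis .
  qed
  have few: "card L * 2 ^ (card I + m + 1) < Q ^ (m + 1)"
  proof -
    have "card L * 2 ^ (card I + m + 1) \<le> card K * (Q * A + 1) ^ m * 2 ^ (card I + m + 1)"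
      by (intro mult_le_mono L order_refl)
    also have "\<dots> \<le> card K * (Q * (A + 1)) ^ m * 2 ^ (card I + m + 1)"
      by (intro mult_le_mono power_mono order_refl) (auto simp: Q_def)
    also have "\<dots> = (card K * (A + 1) ^ m * 2 ^ (card I + m + 1)) * Q ^ m"
      by (simp only: power_mult_distrib mult_ac)
    also have "\<dots> < Q * Q ^ m"
      by (rule mult_strict_right_mono) (auto simp: Q_def)
    finally show ?thesis by simp
  qed
  have "0 < Q" by (simp add: Q_def)
  obtain c :: "'i \<Rightarrow> nat" where c: "\<And>i. i \<in> I \<Longrightarrow> c i < Q"
    "\<And>x. card {i \<in> I. G i x + \<epsilon> * real (c i) / real Q = 0} \<le> m"
    using avoid_zeros[of I L "\<lambda>x. label (f x)" \<epsilon> Q G m, OF \<open>finite I\<close> L(1) L(3)[OF f(2)] \<open>0 < \<epsilon>\<close> \<open>0 < Q\<close> close few]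
    by blast
  show ?thesis
  proof (rule that[of "\<lambda>i x. G i x + \<epsilon> * real (c i) / real Q"])
    show "continuous_on UNIV (\<lambda>x. G i x + \<epsilon> * real (c i) / real Q)" if "i \<in> I" for i
      by (intro continuous_intros contG that)
    show "\<bar>G i x + \<epsilon> * real (c i) / real Q - h i x\<bar> \<le> 2 * \<epsilon>" if "i \<in> I" for i x
    proof -
      have "real (c i) / real Q \<le> 1" using c(1)[OF that] by simp
      then have "\<epsilon> * real (c i) / real Q \<le> \<epsilon>" using mult_left_mono[of "real (c i) / real Q" 1 \<epsilon>] \<open>0 < \<epsilon>\<close> by simp
      moreover have "0 \<le> \<epsilon> * real (c i) / real Q" using \<open>0 < \<epsilon>\<close> by simp
      ultimately show ?thesis using G(2)[OF that, of x] by linarith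
    qed
    show "card {i \<in> I. G i x + \<epsilon> * real (c i) / real Q = 0} \<le> complex_dim K" for x
      using c(2) by (simp add: m_def)
  qed
qed

section \<open>Tilings from power diagrams\<close>

definition sq :: "int ^ 'k \<Rightarrow> int" where "sq n = (\<Sum>i\<in>UNIV. (n $ i)\<^sup>2)"

lemma sq_nonneg: "0 \<le> sq n"
  by (simp add: sq_def sum_nonneg)

lemma sq_minus: "sq (- n) = sq n"
  by (simp add: sq_def)

lemma abs_nth_le_of_sq_le:
  assumes "sq n \<le> B"
  shows "\<bar>n $ i\<bar> \<le> B"
proof -
  have "\<bar>n $ i\<bar> \<le> \<bar>n $ i\<bar>\<^sup>2" using self_le_power[of "\<bar>n $ i\<bar>" 2] by (cases "n $ i = 0") auto
  also have "\<dots> \<le> sq n" unfolding sq_def power2_abs by (rule member_le_sum) auto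
  finally show ?thesis using assms by simp
qed

lemma sq_le:
  fixes n :: "int ^ 'k"
  assumes "\<And>i. \<bar>n $ i\<bar> \<le> R"
  shows "sq n \<le> int CARD('k) * R\<^sup>2"
proof -
  have "sq n \<le> (\<Sum>i\<in>(UNIV :: 'k set). R\<^sup>2)"
    unfolding sq_def using assms by (intro sum_mono) (metis abs_ge_zero abs_le_square_iff abs_of_nonneg order_trans)
  then show ?thesis by simp
qed

text \<open>The grid is anchored at the site \<open>a\<close>, so that the cubes with the same index
  \<open>j\<close> and sides \<open>M\<close> and \<open>M + 1\<close> correspond under dilation
  about \<open>a\<close>.\<close>

definition tile :: "nat \<Rightarrow> int ^ 'k \<Rightarrow> int ^ 'k \<Rightarrow> (int ^ 'k) set"
  where "tile M a j = {n. \<forall>i. int M * j $ i \<le> n $ i - a $ i \<and> n $ i - a $ i < int M * j $ i + int M}"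

lemma tile_eq_image: "tile M a j = (+) (a + (\<chi> i. int M * j $ i)) ` box M"
proof (intro set_eqI iffI)
  fix n assume n: "n \<in> tile M a j"
  show "n \<in> (+) (a + (\<chi> i. int M * j $ i)) ` box M"
  proof (rule image_eqI)
    show "n = a + (\<chi> i. int M * j $ i) + (n - (a + (\<chi> i. int M * j $ i)))" by simp
    show "n - (a + (\<chi> i. int M * j $ i)) \<in> box M"
      unfolding mem_box
    proof
      fix i
      show "0 \<le> (n - (a + (\<chi> i. int M * j $ i))) $ i \<and> (n - (a + (\<chi> i. int M * j $ i))) $ i < int M"
        using n[unfolded tile_def mem_Collect_eq, THEN spec, of i] by auto
    qed
  qed
qed (auto simp: tile_def mem_box)

lemma finite_tile [simp]: "finite (tile M a j)"
  by (simp add: tile_eq_image)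

lemma card_tile: "card (tile M a j :: (int ^ 'k) set) = M ^ CARD('k)"
  by (simp add: tile_eq_image card_image card_box)

lemma tile_index:
  assumes "n \<in> tile M a j"
  shows "j = (\<chi> i. (n $ i - a $ i) div int M)"
proof -
  have "j $ i = (n $ i - a $ i) div int M" for i
  proof -
    have "int M * j $ i \<le> n $ i - a $ i" "n $ i - a $ i < int M * j $ i + int M"
      using assms by (auto simp: tile_def)
    then show ?thesis by (intro int_div_pos_eq[symmetric, where r = "n $ i - a $ i - int M * j $ i"]) auto
  qed
  then show ?thesis by (simp add: vec_eq_iff)
qed

lemma mem_tile:
  assumes "0 < M"
  shows "n \<in> tile M a (\<chi> i. (n $ i - a $ i) div int M)"
  unfolding tile_def mem_Collect_eq
proof
  fix i
  have "int M * ((n $ i - a $ i) div int M) + (n $ i - a $ i) mod int M = n $ i - a $ i"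
    "0 \<le> (n $ i - a $ i) mod int M" "(n $ i - a $ i) mod int M < int M"
    using assms by simp_all
  then show "int M * (\<chi> i. (n $ i - a $ i) div int M) $ i \<le> n $ i - a $ i \<and>
      n $ i - a $ i < int M * (\<chi> i. (n $ i - a $ i) div int M) $ i + int M"
    unfolding vec_lambda_beta by linarith
qed

text \<open>\<open>j\<close> is \<open>z / p\<close> rounded down. This bounds the index of a tile,
  and so its distance from the site, by the distance of the point that selected it.\<close>

lemma abs_quotient_le:
  fixes p z j B :: int
  assumes "1 \<le> p" "p * j \<le> z" "z < p * j + p" "\<bar>z\<bar> \<le> B"
  shows "\<bar>j\<bar> \<le> B"
proof (rule abs_leI)
  have zB: "z \<le> B" "- B \<le> z" "0 \<le> B" using assms(4) by linarith+
  then have pB: "1 * B \<le> p * B" "1 * (B + 1) \<le> p * (B + 1)"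
    using assms(1) by (intro mult_right_mono; simp)+
  show "j \<le> B"
  proof (rule ccontr)
    assume "\<not> j \<le> B"
    then have "p * (B + 1) \<le> p * j" using assms(1) by (intro mult_left_mono) auto
    then have "1 * (B + 1) \<le> z" using pB(2) assms(2) by (meson order_trans)
    then show False using zB(1) by simp
  qed
  show "- j \<le> B"
  proof (rule ccontr)
    assume "\<not> - j \<le> B"
    then have "p * (j + 1) \<le> p * (- B)" using assms(1) by (intro mult_left_mono) auto
    then have "p * j + p \<le> - (p * B)" by (simp add: distrib_left)
    then show False using pB(1) assms(3) zB(2) by linarith
  qed
qed

text \<open>The numbers \<open>sq (x - a) + t a\<close> define a power diagram. Multiplying all weights \<open>t\<close> by
  \<open>(M + 1) / M\<close> replaces the cell of \<open>a\<close> by its dilation about \<open>a\<close> by the same factor, up to an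
  error that pushes it into the interior of the original cell. In the lemma, \<open>y\<close> is compared
  with the scaled weights (hence the coefficient \<open>M\<close>) and \<open>n\<close> with the original ones.\<close>
lemma energy_gap:
  fixes y n a b j :: "int ^ 'k"
  assumes "0 < M" and y: "y \<in> tile (M + 1) a j" and n: "n \<in> tile M a j"
    and sep: "int ((CARD('k) + 3) * M * (M + 1)) \<le> \<bar>b $ l - a $ l\<bar>"
  shows "int M * (sq (y - b) - sq (y - a)) + int (M + 1) \<le> int (M + 1) * (sq (n - b) - sq (n - a))"
proof -
  define E where "E = int (M * (M + 1))"
  define v where "v i = b $ i - a $ i" for i
  define z where "z i = y $ i - a $ i" for i
  define u where "u i = n $ i - a $ i" for i
  \<comment> \<open>Measures how far \<open>n - a\<close> is from an exact scaling of
    \<open>y - a\<close>.\<close>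
  define e where "e i = int (M + 1) * u i - int M * z i" for i
  have e: "\<bar>e i\<bar> \<le> E" for i
  proof -
    have "int (M + 1) * j $ i \<le> z i" "z i \<le> int (M + 1) * j $ i + int M"
      using y[unfolded tile_def mem_Collect_eq, THEN spec, of i] by (auto simp: z_def)
    then have z: "int M * (int (M + 1) * j $ i) \<le> int M * z i"
      "int M * z i \<le> int M * (int (M + 1) * j $ i + int M)"
      by (simp_all only: mult_left_mono of_nat_0_le_iff)
    have "int M * j $ i \<le> u i" "u i \<le> int M * j $ i + int M"
      using n[unfolded tile_def mem_Collect_eq, THEN spec, of i] by (auto simp: u_def)
    then have "int (M + 1) * (int M * j $ i) \<le> int (M + 1) * u i"
      "int (M + 1) * u i \<le> int (M + 1) * (int M * j $ i + int M)"
      by (simp_all only: mult_left_mono of_nat_0_le_iff)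
    with z show ?thesis unfolding e_def E_def by (simp add: algebra_simps)
  qed
  have "E \<ge> int (M + 1)" unfolding E_def using \<open>0 < M\<close> by (simp add: of_nat_mult[symmetric] del: of_nat_mult)
  then have "1 \<le> E" by simp
  \<comment> \<open>Completing the square limits the loss in each coordinate to
    \<open>E\<^sup>2\<close>.\<close>
  have lower: "- (E\<^sup>2) \<le> (v i)\<^sup>2 - 2 * e i * v i" for i
  proof -
    have "(e i)\<^sup>2 \<le> E\<^sup>2" using e[of i] by (metis abs_ge_zero abs_le_square_iff abs_of_nonneg order_trans)
    moreover have "0 \<le> (v i - e i)\<^sup>2" by simp
    ultimately show ?thesis by (simp add: power2_diff algebra_simps)
  qed
  \<comment> \<open>The factor \<open>CARD('k) + 3\<close> is used here: coordinate \<open>l\<close>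
    outweighs the losses in the others and leaves a surplus of at least \<open>E\<^sup>2\<close>,
    hence of \<open>M + 1\<close>.\<close>
  have far: "int (CARD('k) + 1) * E\<^sup>2 \<le> (v l)\<^sup>2 - 2 * e l * v l"
  proof -
    have L: "int (CARD('k) + 3) * E \<le> \<bar>v l\<bar>"
      using sep unfolding E_def v_def by (simp only: of_nat_mult mult.assoc)
    have "e l * v l \<le> \<bar>e l\<bar> * \<bar>v l\<bar>" by (simp add: abs_mult[symmetric])
    also have "\<dots> \<le> E * \<bar>v l\<bar>" by (intro mult_right_mono e) simp
    finally have "e l * v l \<le> E * \<bar>v l\<bar>" .
    then have "\<bar>v l\<bar> * (\<bar>v l\<bar> - 2 * E) \<le> (v l)\<^sup>2 - 2 * e l * v l"
      by (simp add: algebra_simps power2_eq_square abs_mult_self_eq)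
    moreover have "E * (int (CARD('k) + 1) * E) \<le> \<bar>v l\<bar> * (\<bar>v l\<bar> - 2 * E)"
    proof (rule mult_mono)
      have "1 * E \<le> int (CARD('k) + 3) * E" using \<open>1 \<le> E\<close> by (intro mult_right_mono) auto
      then show "E \<le> \<bar>v l\<bar>" using L by simp
      show "int (CARD('k) + 1) * E \<le> \<bar>v l\<bar> - 2 * E" using L by (simp add: algebra_simps)
    qed (use \<open>1 \<le> E\<close> in auto)
    ultimately show ?thesis by (simp add: power2_eq_square algebra_simps)
  qed
  have "(\<Sum>i\<in>UNIV - {l}. - (E\<^sup>2)) \<le> (\<Sum>i\<in>UNIV - {l}. (v i)\<^sup>2 - 2 * e i * v i)"
    by (intro sum_mono lower)
  moreover have "(\<Sum>i\<in>UNIV - {l}. - (E\<^sup>2)) = - (int (CARD('k) - 1) * E\<^sup>2)"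
    by (simp add: card_Diff_singleton)
  moreover have "(\<Sum>i\<in>UNIV. (v i)\<^sup>2 - 2 * e i * v i) =
      ((v l)\<^sup>2 - 2 * e l * v l) + (\<Sum>i\<in>UNIV - {l}. (v i)\<^sup>2 - 2 * e i * v i)"
    by (rule sum.remove) auto
  moreover have "int (CARD('k) - 1) * E\<^sup>2 \<le> int CARD('k) * E\<^sup>2"
    by (intro mult_right_mono) auto
  moreover have "int (CARD('k) + 1) * E\<^sup>2 = int CARD('k) * E\<^sup>2 + E\<^sup>2" by (simp add: algebra_simps)
  moreover have "E \<le> E\<^sup>2" using \<open>1 \<le> E\<close> by (simp add: power2_eq_square)
  ultimately have "int (M + 1) \<le> (\<Sum>i\<in>UNIV. (v i)\<^sup>2 - 2 * e i * v i)"
    using far \<open>E \<ge> int (M + 1)\<close> by linarith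
  \<comment> \<open>The terms \<open>(v i)\<^sup>2\<close> have coefficient \<open>M + 1\<close> on
    one side and \<open>M\<close> on the other; the one that survives is what the scaling of the
    weights gains.\<close>
  also have "\<dots> = int (M + 1) * (sq (n - b) - sq (n - a)) - int M * (sq (y - b) - sq (y - a))"
    unfolding sq_def sum_subtractf[symmetric] sum_distrib_left v_def e_def u_def z_def
    by (intro sum.cong refl) (simp add: power2_eq_square algebra_simps)
  finally show ?thesis by simp
qed

text \<open>A tile \<open>tile M a j\<close> is used as soon as \<open>tile (M + 1) a j\<close> contains a point of the scaled
  cell of \<open>a\<close>, so that the tiles used have density at least \<open>(M / (M + 1)) ^ k\<close>.\<close>
lemma power_diagram_tiles:
  fixes t :: "int ^ 'k \<Rightarrow> real"
  assumes "0 < M" "0 \<le> B" and R: "R = int M * (B + 1)"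
    and C: "C = real_of_int (int CARD('k) * R\<^sup>2 + B + 1)"
    and t: "\<And>b. 0 \<le> t b" "\<And>b. t b \<le> C"
    and sep: "\<And>a b. t a < C \<Longrightarrow> t b < C \<Longrightarrow> a \<noteq> b \<Longrightarrow>
      \<exists>i. int ((CARD('k) + 3) * M * (M + 1)) \<le> \<bar>b $ i - a $ i\<bar>"
    and dense: "\<And>y. \<exists>b. t b = 0 \<and> sq (y - b) \<le> B"
  obtains P where "finite P" "N ^ CARD('k) \<le> card P * (M + 1) ^ CARD('k)"
    and "\<And>a j n i. (a, j) \<in> P \<Longrightarrow> n \<in> tile M a j \<Longrightarrow> \<bar>n $ i - a $ i\<bar> \<le> R"
    and "\<And>a j n b. (a, j) \<in> P \<Longrightarrow> n \<in> tile M a j \<Longrightarrow> b \<noteq> a \<Longrightarrow>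
      real_of_int (sq (n - a)) + t a + 1 \<le> real_of_int (sq (n - b)) + t b"
    and "\<And>a j a' j'. (a, j) \<in> P \<Longrightarrow> (a', j') \<in> P \<Longrightarrow> (a, j) \<noteq> (a', j') \<Longrightarrow> tile M a j \<inter> tile M a' j' = {}"
    and "\<And>a j. (a, j) \<in> P \<Longrightarrow> tile M a j \<subseteq> {n. \<forall>i. - (R + B) \<le> n $ i \<and> n $ i < - (R + B) + int (N + 2 * nat (R + B))}"
proof -
  \<comment> \<open>\<open>M\<close> times the energy for the weights scaled by
    \<open>(M + 1) / M\<close>.\<close>
  define cost where "cost y b = real M * real_of_int (sq (y - b)) + real (M + 1) * t b" for y b
  have "0 \<le> R" unfolding R using \<open>0 \<le> B\<close> by simp
  have cost_le: "\<exists>b. cost y b \<le> real M * real_of_int B \<and> t b = 0 \<and> sq (y - b) \<le> B" for y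
  proof -
    obtain b where "t b = 0" "sq (y - b) \<le> B" using dense by blast
    then show ?thesis by (intro exI[of _ b]) (simp add: cost_def mult_left_mono)
  qed
  have "\<exists>a. \<forall>b. cost y a \<le> cost y b" for y
  proof -
    \<comment> \<open>There are infinitely many candidates, but those no worse than a site of weight
      0 lie near \<open>y\<close>; so a minimum is attained.\<close>
    define S where "S = {b. cost y b \<le> real M * real_of_int B}"
    have S_sq: "sq (y - b) \<le> B" if "b \<in> S" for b
    proof -
      have "0 \<le> real (M + 1) * t b" using t(1) by simp
      then have "real M * real_of_int (sq (y - b)) \<le> real M * real_of_int B"
        using that by (simp add: S_def cost_def)
      then show ?thesis using \<open>0 < M\<close> by simp
    qed
    have "S \<subseteq> (\<lambda>d. y + d) ` {d. \<forall>i. - B \<le> d $ i \<and> d $ i < - B + int (nat (2 * B + 1))}"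
    proof
      fix b assume "b \<in> S"
      then have "\<bar>(y - b) $ i\<bar> \<le> B" for i using S_sq abs_nth_le_of_sq_le by blast
      then have *: "\<bar>y $ i - b $ i\<bar> \<le> B" for i by simp
      have "- B \<le> (b - y) $ i \<and> (b - y) $ i < - B + int (nat (2 * B + 1))" for i
        using *[of i] by auto
      then show "b \<in> (\<lambda>d. y + d) ` {d. \<forall>i. - B \<le> d $ i \<and> d $ i < - B + int (nat (2 * B + 1))}"
        by (intro image_eqI[where x = "b - y"]) auto
    qed
    then have "finite S" by (rule finite_subset) (intro finite_imageI finite_cube)
    moreover have "S \<noteq> {}" using cost_le[of y] by (auto simp: S_def)
    ultimately obtain a where a: "is_arg_min (cost y) (\<lambda>b. b \<in> S) a"
      using ex_is_arg_min_if_finite by blast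
    have "cost y a \<le> cost y b" for b
    proof (cases "b \<in> S")
      case True
      then show ?thesis using a by (simp add: is_arg_min_def not_less)
    next
      case False
      have "cost y a \<le> real M * real_of_int B" using a by (simp add: is_arg_min_def S_def)
      then show ?thesis using False by (simp add: S_def)
    qed
    then show ?thesis by blast
  qed
  \<comment> \<open>\<open>\<alpha> y\<close> is the owner of \<open>y\<close> in the scaled
    diagram.\<close>
  then obtain \<alpha> where \<alpha>: "\<And>y b. cost y (\<alpha> y) \<le> cost y b" by metis
  have \<alpha>_le: "real M * real_of_int (sq (y - \<alpha> y)) + real (M + 1) * t (\<alpha> y) \<le> real M * real_of_int B" for y
    using cost_le[of y] \<alpha>[of y] order_trans unfolding cost_def by blast
  have \<alpha>_sq: "sq (y - \<alpha> y) \<le> B" for y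
  proof -
    have "0 \<le> real (M + 1) * t (\<alpha> y)" using t(1) by simp
    then have "real M * real_of_int (sq (y - \<alpha> y)) \<le> real M * real_of_int B"
      using \<alpha>_le[of y] by linarith
    then show ?thesis using \<open>0 < M\<close> by simp
  qed
  have \<alpha>_t: "t (\<alpha> y) \<le> real_of_int B" for y
  proof -
    have "0 \<le> real M * real_of_int (sq (y - \<alpha> y))" by (simp add: sq_nonneg)
    then have "real (M + 1) * t (\<alpha> y) \<le> real M * real_of_int B" using \<alpha>_le[of y] by linarith
    also have "\<dots> \<le> real (M + 1) * real_of_int B" using \<open>0 \<le> B\<close> by (intro mult_right_mono) auto
    finally show ?thesis by (subst (asm) mult_le_cancel_left_pos) auto
  qed
  define J where "J y = (\<chi> i. (y $ i - \<alpha> y $ i) div int (M + 1))" for y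
  define P where "P = (\<lambda>y. (\<alpha> y, J y)) ` box N"
  have y_tile: "y \<in> tile (M + 1) (\<alpha> y) (J y)" for y
    unfolding J_def by (rule mem_tile) simp
  have bound: "\<bar>n $ i - \<alpha> y $ i\<bar> \<le> R" if n: "n \<in> tile M (\<alpha> y) (J y)" for n y i
  proof -
    have z: "\<bar>y $ i - \<alpha> y $ i\<bar> \<le> B"
      using abs_nth_le_of_sq_le[OF \<alpha>_sq[of y], of i] by simp
    have "\<bar>J y $ i\<bar> \<le> B"
    proof -
      have "int (M + 1) * J y $ i \<le> y $ i - \<alpha> y $ i" "y $ i - \<alpha> y $ i < int (M + 1) * J y $ i + int (M + 1)"
        using y_tile[of y, unfolded tile_def mem_Collect_eq, THEN spec, of i] by auto
      from abs_quotient_le[OF _ this z] show ?thesis by simp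
    qed
    then have "int M * J y $ i \<le> int M * B" "int M * (- B) \<le> int M * J y $ i"
      by (intro mult_left_mono; simp)+
    moreover have "int M * J y $ i \<le> n $ i - \<alpha> y $ i" "n $ i - \<alpha> y $ i < int M * J y $ i + int M"
      using n[unfolded tile_def mem_Collect_eq, THEN spec, of i] by auto
    moreover have "R = int M * B + int M" "int M * (- B) = - (int M * B)"
      by (simp_all add: R algebra_simps)
    ultimately show ?thesis by (intro abs_leI) linarith+
  qed
  have gap: "real_of_int (sq (n - \<alpha> y)) + t (\<alpha> y) + 1 \<le> real_of_int (sq (n - b)) + t b"
    if n: "n \<in> tile M (\<alpha> y) (J y)" and b: "b \<noteq> \<alpha> y" for n y b
  proof (cases "t b < C")
    case True
    have "t (\<alpha> y) < C"
    proof -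
      have "0 \<le> int CARD('k) * R\<^sup>2" by simp
      then have "real_of_int B < C" unfolding C by linarith
      then show ?thesis using \<alpha>_t[of y] by simp
    qed
    then obtain i where "int ((CARD('k) + 3) * M * (M + 1)) \<le> \<bar>b $ i - \<alpha> y $ i\<bar>"
      using sep[OF _ True] b by blast
    from energy_gap[OF \<open>0 < M\<close> y_tile n this]
    have "real_of_int (int M * (sq (y - b) - sq (y - \<alpha> y)) + int (M + 1))
        \<le> real_of_int (int (M + 1) * (sq (n - b) - sq (n - \<alpha> y)))"
      by (simp only: of_int_le_iff)
    then have "real M * (real_of_int (sq (y - b)) - real_of_int (sq (y - \<alpha> y))) + real (M + 1)
        \<le> real (M + 1) * (real_of_int (sq (n - b)) - real_of_int (sq (n - \<alpha> y)))"
      by simp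
    then have "real (M + 1) * (real_of_int (sq (n - \<alpha> y)) + t (\<alpha> y) + 1)
        \<le> real (M + 1) * (real_of_int (sq (n - b)) + t b)"
      using \<alpha>[of y b] unfolding cost_def by (simp add: algebra_simps)
    then show ?thesis by (subst (asm) mult_le_cancel_left_pos) auto
  next
    case False
    \<comment> \<open>Sites of full weight need not be separated from the others. \<open>C\<close>
      is large enough that they lose everywhere on the tile, by the required margin 1.\<close>
    then have "t b = C" using t(2)[of b] by simp
    have "sq (n - \<alpha> y) \<le> int CARD('k) * R\<^sup>2"
      by (rule sq_le) (use bound[OF n] in simp)
    then have "real_of_int (sq (n - \<alpha> y)) \<le> real_of_int (int CARD('k) * R\<^sup>2)" by (simp only: of_int_le_iff)
    then have "real_of_int (sq (n - \<alpha> y)) + t (\<alpha> y) + 1 \<le> C"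
      using \<alpha>_t[of y] unfolding C by simp
    moreover have "0 \<le> real_of_int (sq (n - b))" by (simp add: sq_nonneg)
    ultimately show ?thesis using \<open>t b = C\<close> by linarith
  qed
  show ?thesis
  proof (rule that[of P])
    show "finite P" by (simp add: P_def)
    \<comment> \<open>The larger tiles cover the box, which forces \<open>P\<close> to be
      large.\<close>
    have "box N \<subseteq> (\<Union>(a, j)\<in>P. tile (M + 1) a j)"
      unfolding P_def using y_tile by fastforce
    then have "card (box N :: (int ^ 'k) set) \<le> card (\<Union>(a, j)\<in>P. tile (M + 1) a j)"
      using \<open>finite P\<close> by (intro card_mono) auto
    also have "\<dots> \<le> (\<Sum>(a, j)\<in>P. card (tile (M + 1) a j))"
      using card_UN_le[OF \<open>finite P\<close>, of "\<lambda>(a, j). tile (M + 1) a j"] by (simp add: case_prod_unfold)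
    also have "\<dots> = card P * (M + 1) ^ CARD('k)" by (simp add: card_tile case_prod_unfold)
    finally show "N ^ CARD('k) \<le> card P * (M + 1) ^ CARD('k)" by (simp add: card_box)
    show "\<bar>n $ i - a $ i\<bar> \<le> R" if "(a, j) \<in> P" "n \<in> tile M a j" for a j n i
      using that bound by (auto simp: P_def)
    show gapP: "real_of_int (sq (n - a)) + t a + 1 \<le> real_of_int (sq (n - b)) + t b"
      if "(a, j) \<in> P" "n \<in> tile M a j" "b \<noteq> a" for a j n b
      using that gap by (auto simp: P_def)
    show "tile M a j \<inter> tile M a' j' = {}" if "(a, j) \<in> P" "(a', j') \<in> P" "(a, j) \<noteq> (a', j')" for a j a' j'
    proof (rule ccontr)
      assume "tile M a j \<inter> tile M a' j' \<noteq> {}"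
      then obtain n where n: "n \<in> tile M a j" "n \<in> tile M a' j'" by blast
      have "a = a'"
      proof (rule ccontr)
        assume "a \<noteq> a'"
        then show False
          using gapP[OF that(1) n(1), of a'] gapP[OF that(2) n(2), of a] by simp
      qed
      then show False using tile_index[OF n(1)] tile_index[OF n(2)] that(3) by simp
    qed
    show "tile M a j \<subseteq> {n. \<forall>i. - (R + B) \<le> n $ i \<and> n $ i < - (R + B) + int (N + 2 * nat (R + B))}"
      if aj: "(a, j) \<in> P" for a j
    proof (intro subsetI CollectI allI)
      fix n i assume n: "n \<in> tile M a j"
      obtain y where y: "y \<in> box N" "a = \<alpha> y" "j = J y" using aj by (auto simp: P_def)
      have "\<bar>n $ i - \<alpha> y $ i\<bar> \<le> R" using bound n y by simp
      moreover have "\<bar>y $ i - \<alpha> y $ i\<bar> \<le> B"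
        using abs_nth_le_of_sq_le[OF \<alpha>_sq[of y], of i] by simp
      moreover have "0 \<le> y $ i" "y $ i < int N" using y(1) by (auto simp: mem_box)
      moreover have "0 \<le> R + B" using \<open>0 \<le> R\<close> \<open>0 \<le> B\<close> by simp
      ultimately show "- (R + B) \<le> n $ i \<and> n $ i < - (R + B) + int (N + 2 * nat (R + B))"
        by auto
    qed
  qed
qed

section \<open>Gluing along marker tilings\<close>

context zk_action
begin

lemma T_inverse: "T (- n) (T n x) = x" "T n (T (- n) x) = x"
  using T_add[of "- n" n x] T_add[of n "- n" x] by (simp_all add: T_zero)

text \<open>The distance to the complement of a marker set is positive exactly on the set. By
  compactness it is at least some \<open>\<kappa>\<close> along every orbit within finitely many
  times; dividing by \<open>\<kappa>\<close> and truncating at 1 gives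
  \<open>\<phi>\<close>.\<close>

lemma marker_function:
  assumes "marker_property T" "2 \<le> L"
  obtains \<phi> :: "'a \<Rightarrow> real" and B :: int where "continuous_on UNIV \<phi>" "\<And>x. 0 \<le> \<phi> x" "\<And>x. \<phi> x \<le> 1"
    and "\<And>x m. 0 < \<phi> x \<Longrightarrow> 0 < \<phi> (T m x) \<Longrightarrow> m \<noteq> 0 \<Longrightarrow> \<exists>i. int L \<le> \<bar>m $ i\<bar>"
    and "0 \<le> B" "\<And>x. \<exists>d. \<phi> (T d x) = 1 \<and> sq d \<le> B"
proof -
  define F :: "(int ^ 'k) set" where "F = {n. \<forall>i. \<bar>n $ i\<bar> < int L}"
  have "finite F"
  proof (rule finite_subset[OF _ finite_cube[of "- int L" "2 * L"]], intro subsetI CollectI allI)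
    fix n :: "int ^ 'k" and i assume "n \<in> F"
    then have "\<bar>n $ i\<bar> < int L" unfolding F_def by blast
    then show "- int L \<le> n $ i \<and> n $ i < - int L + int (2 * L)" by auto
  qed
  then have "\<exists>U. open U \<and> (\<Union>n. T n ` U) = UNIV \<and> (\<forall>n\<in>F. n \<noteq> 0 \<longrightarrow> U \<inter> T n ` U = {})"
    using assms(1)[unfolded marker_property_def, THEN spec, of F] by (rule rev_mp)
  then obtain U where U: "open U" "(\<Union>n. T n ` U) = UNIV" "\<And>n. n \<in> F \<Longrightarrow> n \<noteq> 0 \<Longrightarrow> U \<inter> T n ` U = {}"
    by metis
  \<comment> \<open>\<open>infdist\<close> to the empty set is 0 by convention. The hypothesis
    \<open>2 \<le> L\<close> puts a nonzero vector into \<open>F\<close>, which excludes this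
    case.\<close>
  have "U \<noteq> UNIV"
  proof
    assume "U = UNIV"
    define m :: "int ^ 'k" where "m = (\<chi> i. 1)"
    have "m \<in> F" "m \<noteq> 0" using assms(2) by (auto simp: F_def m_def vec_eq_iff)
    then have "U \<inter> T m ` U = {}" by (rule U(3))
    then show False using \<open>U = UNIV\<close> by auto
  qed
  define \<rho> where "\<rho> x = infdist x (- U)" for x
  have \<rho>0: "0 \<le> \<rho> x" for x by (simp add: \<rho>_def infdist_nonneg)
  have \<rho>_pos: "0 < \<rho> x \<longleftrightarrow> x \<in> U" for x
  proof -
    have "- U \<noteq> {}" "closed (- U)" using U(1) \<open>U \<noteq> UNIV\<close> by auto
    then have "x \<in> - U \<longleftrightarrow> \<rho> x = 0" unfolding \<rho>_def by (rule in_closed_iff_infdist_zero[rotated])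
    then show ?thesis using \<rho>0[of x] by auto
  qed
  have cont: "continuous_on UNIV \<rho>" unfolding \<rho>_def by (intro continuous_intros)
  have contT: "continuous_on UNIV (\<lambda>x. \<rho> (T n x))" for n
    by (rule continuous_on_compose2[OF cont continuous_T]) auto
  have "open {x. 0 < \<rho> (T n x)}" for n
    by (rule open_Collect_less) (intro continuous_intros contT)+
  moreover have "\<exists>n. 0 < \<rho> (T n x)" for x
  proof -
    have "x \<in> (\<Union>n. T n ` U)" unfolding U(2) by simp
    then obtain n u where "x = T n u" "u \<in> U" by blast
    then have "0 < \<rho> (T (- n) x)" by (simp add: \<rho>_pos T_inverse)
    then show ?thesis by blast
  qed
  then have "UNIV \<subseteq> (\<Union>n. {x. 0 < \<rho> (T n x)})" by auto
  ultimately obtain D where D: "finite D" "UNIV \<subseteq> (\<Union>n\<in>D. {x. 0 < \<rho> (T n x)})"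
    using compactE_image[OF compact_space, of UNIV "\<lambda>n. {x. 0 < \<rho> (T n x)}"]
    by (metis (no_types, lifting))
  define \<mu> where "\<mu> x = (\<Sum>n\<in>D. \<rho> (T n x))" for x
  have "continuous_on UNIV \<mu>" unfolding \<mu>_def by (intro continuous_intros contT)
  then obtain x0 where x0: "\<And>x. \<mu> x0 \<le> \<mu> x"
    using continuous_attains_inf[OF compact_space, of \<mu>] by auto
  have "0 < \<mu> x0"
  proof -
    obtain n where "n \<in> D" "0 < \<rho> (T n x0)" using D(2) by blast
    then show ?thesis unfolding \<mu>_def using D(1) \<rho>0 by (intro sum_pos2[where i = n])
  qed
  have "D \<noteq> {}" using \<open>0 < \<mu> x0\<close> by (auto simp: \<mu>_def)
  define \<kappa> where "\<kappa> = \<mu> x0 / real (card D)"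
  have "0 < card D" using D(1) \<open>D \<noteq> {}\<close> by (simp add: card_gt_0_iff)
  then have "0 < \<kappa>" using \<open>0 < \<mu> x0\<close> by (simp add: \<kappa>_def)
  \<comment> \<open>\<open>\<kappa>\<close> is the minimal average over \<open>D\<close>, and some
    term reaches the average.\<close>
  have large: "\<exists>n\<in>D. \<kappa> \<le> \<rho> (T n x)" for x
  proof (rule ccontr)
    assume "\<not> ?thesis"
    then have "\<mu> x < (\<Sum>n\<in>D. \<kappa>)"
      unfolding \<mu>_def using D(1) \<open>D \<noteq> {}\<close> by (intro sum_strict_mono) auto
    also have "\<dots> = \<mu> x0" using \<open>0 < card D\<close> by (simp add: \<kappa>_def)
    finally show False using x0[of x] by simp
  qed
  define \<phi> where "\<phi> x = min 1 (\<rho> x / \<kappa>)" for x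
  have \<phi>_pos: "x \<in> U" if "0 < \<phi> x" for x
    using that \<open>0 < \<kappa>\<close> by (auto simp: \<phi>_def \<rho>_pos[symmetric] zero_less_divide_iff)
  show ?thesis
  proof (rule that[of \<phi> "\<Sum>d\<in>D. sq d"])
    show "continuous_on UNIV \<phi>" unfolding \<phi>_def using \<open>0 < \<kappa>\<close> by (intro continuous_intros cont) auto
    show "0 \<le> \<phi> x" "\<phi> x \<le> 1" for x using \<rho>0[of x] \<open>0 < \<kappa>\<close> by (auto simp: \<phi>_def)
    show "\<exists>i. int L \<le> \<bar>m $ i\<bar>" if "0 < \<phi> x" "0 < \<phi> (T m x)" "m \<noteq> 0" for x m
    proof (rule ccontr)
      assume "\<not> ?thesis"
      then have "m \<in> F" by (auto simp: F_def not_le)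
      then have "U \<inter> T m ` U = {}" using that(3) by (rule U(3))
      then show False using \<phi>_pos[OF that(1)] \<phi>_pos[OF that(2)] by blast
    qed
    show "0 \<le> (\<Sum>d\<in>D. sq d)" by (simp add: sum_nonneg sq_nonneg)
    show "\<exists>d. \<phi> (T d x) = 1 \<and> sq d \<le> (\<Sum>d\<in>D. sq d)" for x
    proof -
      obtain d where "d \<in> D" "\<kappa> \<le> \<rho> (T d x)" using large by blast
      moreover from this have "\<phi> (T d x) = 1" using \<open>0 < \<kappa>\<close> by (simp add: \<phi>_def)
      moreover have "sq d \<le> (\<Sum>d\<in>D. sq d)"
        using \<open>d \<in> D\<close> D(1) by (intro member_le_sum) (auto simp: sq_nonneg)
      ultimately show ?thesis by blast
    qed
  qed
qed

lemma sum_indicator_eq_card: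
  "finite \<Omega> \<Longrightarrow> (\<Sum>n\<in>\<Omega>. indicator A (T n x) :: real) = real (card {n \<in> \<Omega>. T n x \<in> A})"
  by (simp add: indicator_def sum.If_cases Int_def Collect_conj_eq[symmetric] conj_commute)

text \<open>The patterns \<open>F\<close> are laid out along the tiles of the cells of the power diagram; the weights
  blend them near the boundaries of the cells, and equal 1 on the tiles of \<open>power_diagram_tiles\<close>.\<close>
lemma glue_patterns:
  fixes F :: "int ^ 'k \<Rightarrow> 'a \<Rightarrow> real"
  assumes "marker_property T" "0 < M"
    and F: "\<And>i. i \<in> box M \<Longrightarrow> continuous_on UNIV (F i)"
      "\<And>i x. i \<in> box M \<Longrightarrow> \<bar>F i x - f (T i x)\<bar> \<le> \<epsilon>"
    and zeros: "\<And>x. card {i \<in> box M. F i x = 0} \<le> d" and "d \<le> M ^ CARD('k)"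
  obtains g :: "'a \<Rightarrow> real" and r :: nat where "continuous_on UNIV g" "\<And>x. \<bar>g x - f x\<bar> \<le> \<epsilon>"
    and "\<And>N x. (M + 1) ^ CARD('k) * card {n \<in> box N. g (T n x) = 0} + N ^ CARD('k) * (M ^ CARD('k) - d)
      \<le> (M + 1) ^ CARD('k) * (N + 2 * r) ^ CARD('k)"
proof -
  define L where "L = (CARD('k) + 3) * M * (M + 1)"
  have "2 * 1 * 1 \<le> L" unfolding L_def using \<open>0 < M\<close> by (intro mult_le_mono) auto
  then have "2 \<le> L" by simp
  obtain \<phi> :: "'a \<Rightarrow> real" and B :: int where \<phi>: "continuous_on UNIV \<phi>" "\<And>x. 0 \<le> \<phi> x" "\<And>x. \<phi> x \<le> 1"
    "\<And>x m. 0 < \<phi> x \<Longrightarrow> 0 < \<phi> (T m x) \<Longrightarrow> m \<noteq> 0 \<Longrightarrow> \<exists>i. int L \<le> \<bar>m $ i\<bar>"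
    "0 \<le> B" "\<And>x. \<exists>d. \<phi> (T d x) = 1 \<and> sq d \<le> B"
    using marker_function[OF assms(1) \<open>2 \<le> L\<close>] by blast
  define R where "R = int M * (B + 1)"
  define C where "C = real_of_int (int CARD('k) * R\<^sup>2 + B + 1)"
  have "0 < C"
  proof -
    have "0 < int CARD('k) * R\<^sup>2 + B + 1" using \<phi>(5) by (simp add: add_nonneg_pos)
    then show ?thesis unfolding C_def by (simp only: of_int_0_less_iff)
  qed
  have "0 \<le> R" using \<phi>(5) by (simp add: R_def)
  \<comment> \<open>A finite window of relative positions. From any point of a tile that
    \<open>power_diagram_tiles\<close> provides, the owner is seen inside \<open>W\<close>.\<close>
  define W :: "(int ^ 'k) set" where "W = {a. \<forall>i. - R \<le> a $ i \<and> a $ i < - R + int (nat (2 * R + 1))}"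
  have W: "finite W" unfolding W_def by (rule finite_cube)
  have mem_W: "a \<in> W" if "\<And>i. \<bar>a $ i\<bar> \<le> R" for a
    unfolding W_def mem_Collect_eq
  proof
    show "- R \<le> a $ i \<and> a $ i < - R + int (nat (2 * R + 1))" for i
      using that[of i] \<open>0 \<le> R\<close> by auto
  qed
  have "W \<noteq> {}" using mem_W[of 0] \<open>0 \<le> R\<close> by auto
  \<comment> \<open>The energy of the origin with respect to the site \<open>a\<close> in the
    diagram of \<open>x\<close>. The weight is 0 where the marker function is 1, and
    \<open>C\<close> where it is 0.\<close>
  define e where "e a x = real_of_int (sq a) + C * (1 - \<phi> (T a x))" for a x
  \<comment> \<open>\<open>wt a x\<close> vanishes as soon as some rival in \<open>W\<close> is
    better by 1, and is positive at a minimiser; the margin 1 in the energy gap is made for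
    this.\<close>
  define wt where "wt a x = (\<Prod>b\<in>W. max 0 (1 + e b x - e a x))" for a x
  define s where "s x = (\<Sum>a\<in>W. wt a x)" for x
  \<comment> \<open>The position of the origin inside its tile of the grid anchored at
    \<open>a\<close>. In \<open>g\<close> the pattern is read from the corner
    \<open>T (- \<tau> a) x\<close>, so each summand approximates \<open>f x\<close> whatever the
    site.\<close>
  define \<tau> :: "int ^ 'k \<Rightarrow> int ^ 'k" where "\<tau> a = (\<chi> i. (- a $ i) mod int M)" for a
  define g where "g x = (\<Sum>a\<in>W. wt a x * F (\<tau> a) (T (- \<tau> a) x)) / s x" for x
  have \<tau>: "\<tau> a \<in> box M" for a using \<open>0 < M\<close> by (simp add: mem_box \<tau>_def)
  have wt0: "0 \<le> wt a x" for a x unfolding wt_def by (intro prod_nonneg) auto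
  have s_pos: "0 < s x" for x
  proof -
    obtain a where "is_arg_min (\<lambda>a. e a x) (\<lambda>a. a \<in> W) a"
      using ex_is_arg_min_if_finite[OF W \<open>W \<noteq> {}\<close>] by blast
    then have a: "a \<in> W" "\<And>b. b \<in> W \<Longrightarrow> e a x \<le> e b x" by (auto simp: is_arg_min_def not_less)
    have "0 < wt a x" unfolding wt_def by (intro prod_pos) (use a(2) in fastforce)
    then show ?thesis unfolding s_def using W a(1) wt0 by (intro sum_pos2[where i = a])
  qed
  have cont_e: "continuous_on UNIV (e a)" for a
    unfolding e_def by (intro continuous_intros continuous_on_compose2[OF \<phi>(1) continuous_T]) auto
  have cont_wt: "continuous_on UNIV (wt a)" for a
    unfolding wt_def by (intro continuous_intros cont_e)
  show ?thesis
  proof (rule that[of g "nat (R + B)"])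
    have "continuous_on UNIV s" unfolding s_def by (intro continuous_intros cont_wt)
    moreover have "continuous_on UNIV (\<lambda>x. F (\<tau> a) (T (- \<tau> a) x))" for a
      by (rule continuous_on_compose2[OF F(1)[OF \<tau>] continuous_T]) auto
    ultimately show "continuous_on UNIV g"
      unfolding g_def using s_pos by (intro continuous_intros cont_wt) (auto simp: less_imp_neq[THEN not_sym])
    show "\<bar>g x - f x\<bar> \<le> \<epsilon>" for x
    proof -
      have "g x - f x = (\<Sum>a\<in>W. wt a x * (F (\<tau> a) (T (- \<tau> a) x) - f x)) / s x"
        using s_pos[of x] by (simp add: g_def s_def right_diff_distrib sum_subtractf diff_divide_distrib
            sum_distrib_right[symmetric])
      also have "\<bar>\<dots>\<bar> \<le> (\<Sum>a\<in>W. \<bar>wt a x * (F (\<tau> a) (T (- \<tau> a) x) - f x)\<bar>) / s x"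
        using s_pos[of x] by (simp add: divide_right_mono sum_abs)
      also have "\<dots> \<le> (\<Sum>a\<in>W. wt a x * \<epsilon>) / s x"
      proof (intro divide_right_mono sum_mono)
        fix a
        have "\<bar>F (\<tau> a) (T (- \<tau> a) x) - f x\<bar> \<le> \<epsilon>"
          using F(2)[OF \<tau>, of a "T (- \<tau> a) x"] by (simp add: T_inverse)
        then show "\<bar>wt a x * (F (\<tau> a) (T (- \<tau> a) x) - f x)\<bar> \<le> wt a x * \<epsilon>"
          using wt0[of a x] by (simp add: abs_mult mult_left_mono)
      qed (use s_pos[of x] in simp)
      also have "\<dots> = \<epsilon>" using s_pos[of x] by (simp add: s_def sum_distrib_right[symmetric])
      finally show ?thesis .
    qed
    fix N x
    define t where "t b = C * (1 - \<phi> (T b x))" for b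
    have t0: "0 \<le> t b" and tC: "t b \<le> C" for b
      using \<phi>(2,3)[of "T b x"] \<open>0 < C\<close> by (auto simp: t_def mult_left_le)
    have sep: "\<exists>i. int L \<le> \<bar>b $ i - a $ i\<bar>" if "t a < C" "t b < C" "a \<noteq> b" for a b
    proof -
      have "0 < \<phi> (T a x)" "0 < \<phi> (T (b - a) (T a x))"
        using that \<open>0 < C\<close> by (auto simp: t_def T_add[symmetric])
      then show ?thesis using \<phi>(4)[of "T a x" "b - a"] that(3) by auto
    qed
    have dense: "\<exists>b. t b = 0 \<and> sq (y - b) \<le> B" for y
    proof -
      obtain d where "\<phi> (T d (T y x)) = 1" "sq d \<le> B" using \<phi>(6) by blast
      then have "t (d + y) = 0 \<and> sq (y - (d + y)) \<le> B"
        by (simp add: t_def T_add sq_minus)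
      then show ?thesis by blast
    qed
    obtain P where P: "finite P" "N ^ CARD('k) \<le> card P * (M + 1) ^ CARD('k)"
      "\<And>a j n i. (a, j) \<in> P \<Longrightarrow> n \<in> tile M a j \<Longrightarrow> \<bar>n $ i - a $ i\<bar> \<le> R"
      "\<And>a j n b. (a, j) \<in> P \<Longrightarrow> n \<in> tile M a j \<Longrightarrow> b \<noteq> a \<Longrightarrow>
        real_of_int (sq (n - a)) + t a + 1 \<le> real_of_int (sq (n - b)) + t b"
      "\<And>a j a' j'. (a, j) \<in> P \<Longrightarrow> (a', j') \<in> P \<Longrightarrow> (a, j) \<noteq> (a', j') \<Longrightarrow> tile M a j \<inter> tile M a' j' = {}"
      "\<And>a j. (a, j) \<in> P \<Longrightarrow> tile M a j \<subseteq> {n. \<forall>i. - (R + B) \<le> n $ i \<and> n $ i < - (R + B) + int (N + 2 * nat (R + B))}"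
      using power_diagram_tiles[OF \<open>0 < M\<close> \<phi>(5) R_def C_def t0 tC sep[unfolded L_def] dense, where N = N] by blast
    define Z where "Z = {n. g (T n x) = 0}"
    have tile_zeros: "card (tile M a j \<inter> Z) \<le> d" if aj: "(a, j) \<in> P" for a j
    proof -
      define c where "c = a + (\<chi> i. int M * j $ i)"
      have g_eq: "g (T n x) = F (n - c) (T c x)" if n: "n \<in> tile M a j" for n
      proof -
        \<comment> \<open>Seen from \<open>T n x\<close>, the site \<open>a\<close> lies at
          \<open>a - n\<close>. Energies move along with the base point, so \<open>a0\<close> is the
          only site of nonzero weight.\<close>
        define a0 where "a0 = a - n"
        have "a0 \<in> W" using P(3)[OF aj n] by (intro mem_W) (simp add: a0_def abs_minus_commute)
        have e_eq: "e b (T n x) = real_of_int (sq (n - (b + n))) + t (b + n)" for b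
          by (simp add: e_def t_def T_add sq_minus)
        have "wt b (T n x) = 0" if "b \<in> W" "b \<noteq> a0" for b
        proof -
          have "b + n \<noteq> a" using that(2) by (auto simp: a0_def)
          then have "e a0 (T n x) + 1 \<le> e b (T n x)"
            using P(4)[OF aj n, of "b + n"] unfolding e_eq by (simp add: a0_def)
          then have "max 0 (1 + e a0 (T n x) - e b (T n x)) = 0" by simp
          then show ?thesis unfolding wt_def using \<open>a0 \<in> W\<close> W by (intro prod_zero) auto
        qed
        then have sum_eq: "(\<Sum>b\<in>W. wt b (T n x) * q b) = wt a0 (T n x) * q a0" for q
          using W \<open>a0 \<in> W\<close> by (subst sum.remove[of W a0]) auto
        have s_eq: "s (T n x) = wt a0 (T n x)"
          using sum_eq[of "\<lambda>_. 1"] by (simp add: s_def)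
        have "\<tau> a0 = n - c"
        proof -
          have "\<tau> a0 $ i = (n - c) $ i" for i
          proof -
            have "int M * j $ i \<le> n $ i - a $ i" "n $ i - a $ i < int M * j $ i + int M"
              using n by (auto simp: tile_def)
            then have "(n $ i - a $ i) mod int M = n $ i - a $ i - int M * j $ i"
              by (intro int_mod_pos_eq[where q = "j $ i"]) auto
            then show ?thesis by (simp add: \<tau>_def a0_def c_def)
          qed
          then show ?thesis by (simp add: vec_eq_iff)
        qed
        then have "g (T n x) = F (n - c) (T (- (n - c)) (T n x))"
          unfolding g_def using sum_eq[of "\<lambda>b. F (\<tau> b) (T (- \<tau> b) (T n x))"] s_eq s_pos[of "T n x"] by simp
        also have "T (- (n - c)) (T n x) = T c x" by (simp add: T_add[symmetric])
        finally show ?thesis .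
      qed
      have "tile M a j \<inter> Z = (+) c ` {i \<in> box M. F i (T c x) = 0}"
        unfolding tile_eq_image c_def[symmetric] Z_def using g_eq by (auto simp: tile_eq_image c_def[symmetric])
      then show ?thesis using zeros[of "T c x"] by (simp add: card_image)
    qed
    define X :: "(int ^ 'k) set" where "X = {n. \<forall>i. - (R + B) \<le> n $ i \<and> n $ i < - (R + B) + int (N + 2 * nat (R + B))}"
    define V where "V = (\<Union>(a, j)\<in>P. tile M a j)"
    have "finite X" unfolding X_def by (rule finite_cube)
    have card_X: "card X = (N + 2 * nat (R + B)) ^ CARD('k)" unfolding X_def by (rule card_cube)
    have tile_X: "tile M a j \<subseteq> X" if "(a, j) \<in> P" for a j
      unfolding X_def using that by (rule P(6))
    then have "V \<subseteq> X" unfolding V_def by blast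
    have disj: "\<forall>p\<in>P. \<forall>q\<in>P. p \<noteq> q \<longrightarrow> (case p of (a, j) \<Rightarrow> tile M a j) \<inter> (case q of (a, j) \<Rightarrow> tile M a j) = {}"
    proof (intro ballI impI)
      fix p q assume "p \<in> P" "q \<in> P" "p \<noteq> q"
      then show "(case p of (a, j) \<Rightarrow> tile M a j) \<inter> (case q of (a, j) \<Rightarrow> tile M a j) = {}"
        using P(5)[of "fst p" "snd p" "fst q" "snd q"] by (simp add: case_prod_unfold)
    qed
    have card_V: "card V = card P * M ^ CARD('k)"
      unfolding V_def by (subst card_UN_disjoint[OF P(1) _ disj]) (auto simp: card_tile case_prod_unfold)
    have "card (V \<inter> Z) \<le> (\<Sum>(a, j)\<in>P. card (tile M a j \<inter> Z))"
      using card_UN_le[OF P(1), of "\<lambda>(a, j). tile M a j \<inter> Z"]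
      by (simp add: V_def case_prod_unfold Int_UN_distrib2)
    also have "\<dots> \<le> (\<Sum>(a, j)\<in>P. d)" by (intro sum_mono) (auto intro: tile_zeros)
    finally have card_VZ: "card (V \<inter> Z) \<le> card P * d" by (simp add: case_prod_unfold)
    have "box N \<subseteq> X"
      unfolding X_def
    proof (intro subsetI CollectI allI)
      fix n :: "int ^ 'k" and i assume "n \<in> box N"
      then have "0 \<le> n $ i" "n $ i < int N" by (auto simp: mem_box)
      then show "- (R + B) \<le> n $ i \<and> n $ i < - (R + B) + int (N + 2 * nat (R + B))"
        using \<open>0 \<le> R\<close> \<phi>(5) by auto
    qed
    \<comment> \<open>Everything outside the tiles is given up as possible zeros.\<close>
    then have "{n \<in> box N. g (T n x) = 0} \<subseteq> (X - V) \<union> (V \<inter> Z)" by (auto simp: Z_def)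
    then have "card {n \<in> box N. g (T n x) = 0} \<le> card ((X - V) \<union> (V \<inter> Z))"
      using \<open>finite X\<close> \<open>V \<subseteq> X\<close> by (intro card_mono) (auto intro: finite_subset)
    also have "\<dots> \<le> card (X - V) + card (V \<inter> Z)" by (rule card_Un_le)
    also have "\<dots> \<le> (card X - card V) + card P * d"
      using card_VZ card_Diff_subset[of V X] \<open>finite X\<close> \<open>V \<subseteq> X\<close> finite_subset by fastforce
    finally have "card {n \<in> box N. g (T n x) = 0} + card P * M ^ CARD('k)
        \<le> (N + 2 * nat (R + B)) ^ CARD('k) + card P * d"
      using card_mono[OF \<open>finite X\<close> \<open>V \<subseteq> X\<close>] card_X card_V by linarith
    moreover have "card P * M ^ CARD('k) = card P * (M ^ CARD('k) - d) + card P * d"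
      using \<open>d \<le> M ^ CARD('k)\<close> by (simp add: distrib_left[symmetric])
    ultimately have main: "card {n \<in> box N. g (T n x) = 0} + card P * (M ^ CARD('k) - d)
        \<le> (N + 2 * nat (R + B)) ^ CARD('k)" by linarith
    have "(M + 1) ^ CARD('k) * card {n \<in> box N. g (T n x) = 0} + N ^ CARD('k) * (M ^ CARD('k) - d)
        \<le> (M + 1) ^ CARD('k) * card {n \<in> box N. g (T n x) = 0}
          + card P * (M + 1) ^ CARD('k) * (M ^ CARD('k) - d)"
      by (intro add_left_mono mult_right_mono P(2)) simp
    also have "\<dots> = (M + 1) ^ CARD('k) * (card {n \<in> box N. g (T n x) = 0} + card P * (M ^ CARD('k) - d))"
      by (simp only: distrib_left mult_ac)
    also have "\<dots> \<le> (M + 1) ^ CARD('k) * (N + 2 * nat (R + B)) ^ CARD('k)"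
      by (intro mult_left_mono main) simp
    finally show "(M + 1) ^ CARD('k) * card {n \<in> box N. g (T n x) = 0} + N ^ CARD('k) * (M ^ CARD('k) - d)
      \<le> (M + 1) ^ CARD('k) * (N + 2 * nat (R + B)) ^ CARD('k)" .
  qed
qed

end

section \<open>Density and openness\<close>

context zk_action
begin

text \<open>The order of choices matters: \<open>M\<close> depends on the modulus of continuity of
  \<open>f\<close> and on \<open>\<delta>\<close>, the radius \<open>r\<close> on the patterns of
  side \<open>M\<close>, and \<open>N\<close> comes last to make \<open>r / N\<close> small.\<close>

lemma approximation_with_few_zeros:
  fixes f :: "'a \<Rightarrow> real"
  assumes "marker_property T" "mdim T = 0" "continuous_on UNIV f" "0 < \<epsilon>" "0 < \<eta>"
  obtains g :: "'a \<Rightarrow> real" and N where "continuous_on UNIV g" "\<And>x. \<bar>g x - f x\<bar> \<le> \<epsilon>"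
    and "1 \<le> N" "visits {x. g x = 0} (box N) < \<eta> * real N ^ CARD('k)"
proof -
  let ?k = "CARD('k)"
  \<comment> \<open>Zeros inside tiles and the part missed by tiles cost about
    \<open>\<delta>\<close> each, so \<open>\<eta> - 2 * \<delta>\<close> is left for the
    boundary.\<close>
  define \<delta> where "\<delta> = min \<eta> 1 / 4"
  have \<delta>: "0 < \<delta>" "\<delta> < 1" "2 * \<delta> < \<eta>" using \<open>0 < \<eta>\<close> by (auto simp: \<delta>_def)
  obtain \<epsilon>' where \<epsilon>': "0 < \<epsilon>'" "\<And>x y. dist x y < \<epsilon>' \<Longrightarrow> \<bar>f x - f y\<bar> < \<epsilon> / 2"
    using compact_uniformly_continuous[OF assms(3) compact_space] half_gt_zero[OF \<open>0 < \<epsilon>\<close>]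
    unfolding uniformly_continuous_on_def dist_real_def by (metis UNIV_I dist_commute)
  have "(\<lambda>M. (real M / real (Suc M)) ^ ?k) \<longlonglongrightarrow> 1 ^ ?k"
    by (intro tendsto_power LIMSEQ_n_over_Suc_n)
  then have "\<forall>\<^sub>F M in sequentially. 1 - \<delta> < (real M / real (Suc M)) ^ ?k"
    using \<delta>(1) by (intro order_tendstoD(1)) auto
  moreover have "\<forall>\<^sub>F M in sequentially. real (box_widim \<epsilon>' M) / real M ^ ?k < \<delta>"
    using order_tendstoD(2)[OF mdim_zero_widim[OF assms(2) \<epsilon>'(1)] \<delta>(1)] .
  moreover have "\<forall>\<^sub>F M in sequentially. 1 \<le> M" by (rule eventually_ge_at_top)
  ultimately have "\<forall>\<^sub>F M in sequentially. 1 - \<delta> < (real M / real (Suc M)) ^ ?k \<and>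
      real (box_widim \<epsilon>' M) / real M ^ ?k < \<delta> \<and> 1 \<le> M"
    by (intro eventually_conj)
  then obtain M where M: "1 - \<delta> < (real M / real (Suc M)) ^ ?k"
    "real (box_widim \<epsilon>' M) / real M ^ ?k < \<delta>" "1 \<le> M"
    unfolding eventually_sequentially by blast
  have ne: "(box M :: (int ^ 'k) set) \<noteq> {}" using M(3) by (simp add: box_eq_empty_iff)
  obtain K \<pi> where K: "widim_map \<epsilon>' (dyn_dist T (box M)) K \<pi>" "complex_dim K = box_widim \<epsilon>' M"
    using widim_map_optimal[OF finite_box ne \<epsilon>'(1)] by blast
  define d where "d = complex_dim K"
  have d: "real d < \<delta> * real M ^ ?k"
    using M(2,3) by (simp add: d_def K(2) pos_divide_less_eq)
  also have "\<dots> \<le> 1 * real M ^ ?k" using \<delta> by (intro mult_right_mono) auto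
  finally have "real d \<le> real (M ^ ?k)" by simp
  then have d_le: "d \<le> M ^ ?k" by (simp only: of_nat_le_iff)
  have near: "\<bar>f (T i x) - f (T i y)\<bar> < \<epsilon> / 2" if i: "i \<in> box M" and eq: "\<pi> x = \<pi> y" for i x y
  proof -
    obtain e where "e < \<epsilon>'" "\<And>x' y'. \<pi> x' = \<pi> x \<Longrightarrow> \<pi> y' = \<pi> x \<Longrightarrow> dyn_dist T (box M) x' y' \<le> e"
      using K(1) unfolding widim_map_iff[of "dyn_dist T (box M)", OF dyn_dist_le_diameter[OF ne]] by blast
    then have "dyn_dist T (box M) x y < \<epsilon>'" using eq by (metis le_less_trans)
    then have "dist (T i x) (T i y) < \<epsilon>'" using dyn_dist_upper[OF i, of x y] by linarith
    then show ?thesis by (rule \<epsilon>'(2))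
  qed
  obtain F where F: "\<And>i. i \<in> box M \<Longrightarrow> continuous_on UNIV (F i)"
    "\<And>i x. i \<in> box M \<Longrightarrow> \<bar>F i x - f (T i x)\<bar> \<le> 2 * (\<epsilon> / 2)"
    "\<And>x. card {i \<in> box M. F i x = 0} \<le> complex_dim K"
  proof (rule generic_perturbation[of "box M :: (int ^ 'k) set" "\<lambda>i x. f (T i x)" K \<pi> "\<epsilon> / 2"])
    show "continuous_on UNIV (\<lambda>x. f (T i x))" for i
      by (rule continuous_on_compose2[OF assms(3) continuous_T]) auto
    show "fin_simplicial_complex K" "continuous_on UNIV \<pi>" "\<pi> x \<in> realization K" for x
      using K(1) by (auto simp: widim_map_def)
  qed (use compact_space near \<open>0 < \<epsilon>\<close> in auto)
  have M0: "0 < M" using M(3) by simp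
  have F': "\<bar>F i x - f (T i x)\<bar> \<le> \<epsilon>" if "i \<in> box M" for i x using F(2)[OF that, of x] by simp
  obtain g :: "'a \<Rightarrow> real" and r :: nat where g: "continuous_on UNIV g" "\<And>x. \<bar>g x - f x\<bar> \<le> \<epsilon>"
    "\<And>N x. (M + 1) ^ ?k * card {n \<in> box N. g (T n x) = 0} + N ^ ?k * (M ^ ?k - d)
      \<le> (M + 1) ^ ?k * (N + 2 * r) ^ ?k"
    using glue_patterns[of M F f \<epsilon> d, OF assms(1) M0 F(1) F' F(3)[folded d_def] d_le] by blast
  have "(\<lambda>N. (1 + real (2 * r) / real N) ^ ?k) \<longlonglongrightarrow> (1 + 0) ^ ?k"
    by (intro tendsto_intros lim_const_over_n)
  then have "\<forall>\<^sub>F N in sequentially. (1 + real (2 * r) / real N) ^ ?k < 1 + (\<eta> - 2 * \<delta>)"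
    using \<delta>(3) by (intro order_tendstoD(2)) auto
  moreover have "\<forall>\<^sub>F N in sequentially. 1 \<le> N" by (rule eventually_ge_at_top)
  ultimately have "\<forall>\<^sub>F N in sequentially. (1 + real (2 * r) / real N) ^ ?k < 1 + (\<eta> - 2 * \<delta>) \<and> 1 \<le> N"
    by (rule eventually_conj)
  then obtain N where N: "(1 + real (2 * r) / real N) ^ ?k < 1 + (\<eta> - 2 * \<delta>)" "1 \<le> N"
    unfolding eventually_sequentially by blast
  have "0 < real N ^ ?k" using N(2) by simp
  define c where "c = real N ^ ?k * ((1 + real (2 * r) / real N) ^ ?k - (1 - \<delta>) * (1 - \<delta>))"
  have "(\<Sum>n\<in>box N. indicator {x. g x = 0} (T n x)) \<le> c" for x
  proof -
    define z where "z = real (card {n \<in> box N. g (T n x) = 0})"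
    have p: "0 < real (M + 1) ^ ?k" by simp
    have "real ((M + 1) ^ ?k * card {n \<in> box N. g (T n x) = 0} + N ^ ?k * (M ^ ?k - d))
        \<le> real ((M + 1) ^ ?k * (N + 2 * r) ^ ?k)"
      using g(3) by (simp only: of_nat_le_iff)
    then have le: "real (M + 1) ^ ?k * z + real N ^ ?k * (real M ^ ?k - real d)
        \<le> real (M + 1) ^ ?k * real (N + 2 * r) ^ ?k"
      using d_le unfolding z_def by (simp only: of_nat_add of_nat_mult of_nat_power of_nat_diff)
    have "real (M + 1) ^ ?k * ((1 - \<delta>) * (1 - \<delta>)) \<le> real (M + 1) ^ ?k * ((1 - \<delta>) * (real M / real (Suc M)) ^ ?k)"
      using M(1) \<delta>(2) by (intro mult_left_mono) auto
    also have "\<dots> = (1 - \<delta>) * real M ^ ?k" by (simp add: power_divide add.commute)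
    also have "\<dots> \<le> real M ^ ?k - real d" using d by (simp add: algebra_simps)
    finally have *: "real N ^ ?k * (real (M + 1) ^ ?k * ((1 - \<delta>) * (1 - \<delta>))) \<le> real N ^ ?k * (real M ^ ?k - real d)"
      by (intro mult_left_mono) auto
    have "real (M + 1) ^ ?k * z \<le> real (M + 1) ^ ?k * (real (N + 2 * r) ^ ?k - real N ^ ?k * ((1 - \<delta>) * (1 - \<delta>)))"
    proof -
      have "p * z \<le> p * (a - n * q)" if "p * z + b \<le> p * a" "n * (p * q) \<le> b" for p a n q b :: real
        using that by (simp add: right_diff_distrib mult.left_commute)
      from this[OF le *] show ?thesis .
    qed
    then have "z \<le> real (N + 2 * r) ^ ?k - real N ^ ?k * ((1 - \<delta>) * (1 - \<delta>))"
      using p by (rule mult_left_le_imp_le)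
    also have "real (N + 2 * r) ^ ?k = real N ^ ?k * (1 + real (2 * r) / real N) ^ ?k"
      using N(2) by (simp add: power_mult_distrib[symmetric] distrib_left)
    finally show ?thesis by (simp add: sum_indicator_eq_card z_def c_def right_diff_distrib)
  qed
  then have "visits {x. g x = 0} (box N) \<le> c" by (rule visits_least)
  also have "c < \<eta> * real N ^ ?k"
  proof -
    have "1 - 2 * \<delta> \<le> (1 - \<delta>) * (1 - \<delta>)" by (simp add: algebra_simps)
    then have "(1 + real (2 * r) / real N) ^ ?k - (1 - \<delta>) * (1 - \<delta>) < \<eta>" using N(1) by linarith
    then show ?thesis unfolding c_def using \<open>0 < real N ^ ?k\<close> by simp
  qed
  finally show ?thesis using that[OF g(1,2) N(2)] by simp
qed

text \<open>For each of the finitely many \<open>S\<close> with at least \<open>c\<close> elements,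
  compactness keeps \<open>f\<close> from being uniformly small on the times \<open>S\<close> of any
  orbit, so no nearby function vanishes on all of them.\<close>

lemma open_few_zeros: "open {f :: 'a \<Rightarrow>\<^sub>C real. visits {x. f x = 0} (box N) < c}"
  unfolding open_dist
proof (intro ballI, unfold mem_Collect_eq)
  fix f :: "'a \<Rightarrow>\<^sub>C real"
  assume f: "visits {x. f x = 0} (box N) < c"
  have card_eq: "(\<Sum>n\<in>box N. indicator {x. h x = 0} (T n x)) = real (card {n \<in> box N. h (T n x) = 0})"
    for h :: "'a \<Rightarrow>\<^sub>C real" and x
    by (simp add: sum_indicator_eq_card)
  define Sets where "Sets = {S. S \<subseteq> (box N :: (int ^ 'k) set) \<and> c \<le> real (card S)}"
  have "finite Sets" by (rule finite_subset[of _ "Pow (box N)"]) (auto simp: Sets_def)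
  have "\<exists>e>0. \<forall>x. e \<le> (\<Sum>n\<in>S. \<bar>f (T n x)\<bar>)" if S: "S \<in> Sets" for S
  proof -
    have fin: "finite S" using S finite_subset[OF _ finite_box] by (auto simp: Sets_def)
    have "continuous_on UNIV (\<lambda>x. f (T n x))" for n
      by (rule continuous_on_compose2[OF continuous_on_apply_bcontfun continuous_T]) auto
    then have "continuous_on UNIV (\<lambda>x. \<Sum>n\<in>S. \<bar>f (T n x)\<bar>)" by (intro continuous_intros)
    then obtain x0 where x0: "\<And>x. (\<Sum>n\<in>S. \<bar>f (T n x0)\<bar>) \<le> (\<Sum>n\<in>S. \<bar>f (T n x)\<bar>)"
      using continuous_attains_inf[OF compact_space, of "\<lambda>x. \<Sum>n\<in>S. \<bar>f (T n x)\<bar>"] by auto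
    have "(\<Sum>n\<in>S. \<bar>f (T n x0)\<bar>) \<noteq> 0"
    proof
      assume "(\<Sum>n\<in>S. \<bar>f (T n x0)\<bar>) = 0"
      then have "S \<subseteq> {n \<in> box N. f (T n x0) = 0}"
        using S fin by (auto simp: Sets_def sum_nonneg_eq_0_iff)
      then have "real (card S) \<le> real (card {n \<in> box N. f (T n x0) = 0})"
        by (simp add: card_mono)
      also have "\<dots> \<le> visits {x. f x = 0} (box N)"
        unfolding card_eq[symmetric] by (rule visits_upper)
      finally show False using f S by (simp add: Sets_def)
    qed
    then have "0 < (\<Sum>n\<in>S. \<bar>f (T n x0)\<bar>)" by (simp add: sum_nonneg less_le)
    then show ?thesis using x0 by blast
  qed
  then obtain e where e: "\<And>S. S \<in> Sets \<Longrightarrow> 0 < e S" "\<And>S x. S \<in> Sets \<Longrightarrow> e S \<le> (\<Sum>n\<in>S. \<bar>f (T n x)\<bar>)"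
    by metis
  \<comment> \<open>The 1 inserted covers the case of no such \<open>S\<close>; the 1 in the
    denominator keeps it positive and makes the later estimate strict.\<close>
  define e0 where "e0 = Min (insert 1 (e ` Sets)) / (real (card (box N :: (int ^ 'k) set)) + 1)"
  have Min_pos: "0 < Min (insert 1 (e ` Sets))" using \<open>finite Sets\<close> e(1) by simp
  then have "0 < e0" by (simp add: e0_def)
  have "visits {x. g x = 0} (box N) < c" if g: "dist g f < e0" for g :: "'a \<Rightarrow>\<^sub>C real"
  proof -
    have few: "real (card {n \<in> box N. g (T n x) = 0}) < c" for x
    proof (rule ccontr)
      define S where "S = {n \<in> box N. g (T n x) = 0}"
      assume "\<not> ?thesis"
      then have S: "S \<in> Sets" by (simp add: S_def Sets_def not_less)
      have "\<bar>f (T n x)\<bar> \<le> e0" if "n \<in> S" for n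
        using dist_fun_lt_imp_dist_val_lt[OF g, of "T n x"] that by (simp add: S_def dist_real_def)
      then have "(\<Sum>n\<in>S. \<bar>f (T n x)\<bar>) \<le> real (card S) * e0"
        by (rule sum_bounded_above)
      also have "\<dots> < (real (card (box N :: (int ^ 'k) set)) + 1) * e0"
      proof -
        have "card S \<le> card (box N :: (int ^ 'k) set)" by (intro card_mono) (auto simp: S_def)
        then show ?thesis using \<open>0 < e0\<close> by (intro mult_strict_right_mono) auto
      qed
      also have "\<dots> = Min (insert 1 (e ` Sets))"
      proof -
        have "real (card (box N :: (int ^ 'k) set)) + 1 \<noteq> 0" by linarith
        then show ?thesis by (simp add: e0_def)
      qed
      also have "\<dots> \<le> e S" using S \<open>finite Sets\<close> by (intro Min_le) auto
      finally show False using e(2)[OF S, of x] by simp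
    qed
    \<comment> \<open>Strict bounds for every \<open>x\<close> need not survive the supremum; counts
      being integers, they are at most \<open>\<lceil>c\<rceil> - 1\<close>.\<close>
    have "visits {x. g x = 0} (box N) \<le> real_of_int (\<lceil>c\<rceil> - 1)"
    proof (rule visits_least)
      fix x
      have "int (card {n \<in> box N. g (T n x) = 0}) < \<lceil>c\<rceil>"
        using few[of x] by (simp add: less_ceiling_iff)
      then have "real_of_int (int (card {n \<in> box N. g (T n x) = 0})) \<le> real_of_int (\<lceil>c\<rceil> - 1)"
        by (simp only: of_int_le_iff)
      then show "(\<Sum>n\<in>box N. indicator {x. g x = 0} (T n x)) \<le> real_of_int (\<lceil>c\<rceil> - 1)"
        unfolding card_eq by simp
    qed
    also have "\<dots> < c" by linarith
    finally show ?thesis .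
  qed
  then show "\<exists>e>0. \<forall>g. dist g f < e \<longrightarrow> visits {x. g x = 0} (box N) < c"
    using \<open>0 < e0\<close> by blast
qed

end

theorem theorem5p3:
  fixes T :: "int ^ 'k \<Rightarrow> 'a::metric_space \<Rightarrow> 'a"
  assumes "zk_system T"
    and "marker_property T"
    and "mdim T = 0"
  shows "gdelta_in euclidean {f :: 'a \<Rightarrow>\<^sub>C real. ocap T {x. f x = 0} = 0}
       \<and> closure {f :: 'a \<Rightarrow>\<^sub>C real. ocap T {x. f x = 0} = 0} = UNIV"
proof -
  interpret zk_action T by (unfold_locales) (rule assms(1))
  define O' where "O' m = (\<Union>N\<in>{1..}. {f :: 'a \<Rightarrow>\<^sub>C real.
    visits {x. f x = 0} (box N) < inverse (real (Suc m)) * real N ^ CARD('k)})" for m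
  have eq: "{f :: 'a \<Rightarrow>\<^sub>C real. ocap T {x. f x = 0} = 0} = \<Inter>(range O')"
  proof (intro set_eqI iffI)
    fix f assume "f \<in> {f :: 'a \<Rightarrow>\<^sub>C real. ocap T {x. f x = 0} = 0}"
    then have "\<exists>N\<ge>1. visits {x. f x = 0} (box N) < inverse (real (Suc m)) * real N ^ CARD('k)" for m
      unfolding mem_Collect_eq ocap_eq_zero_iff by simp
    then show "f \<in> \<Inter>(range O')" by (auto simp: O'_def)
  next
    fix f assume f: "f \<in> \<Inter>(range O')"
    have "\<exists>N\<ge>1. visits {x. f x = 0} (box N) < \<delta> * real N ^ CARD('k)" if "0 < \<delta>" for \<delta>
    proof -
      obtain m where m: "inverse (real (Suc m)) < \<delta>" using reals_Archimedean[OF \<open>0 < \<delta>\<close>] by blast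
      obtain N where N: "1 \<le> N" "visits {x. f x = 0} (box N) < inverse (real (Suc m)) * real N ^ CARD('k)"
        using f unfolding O'_def by auto
      have "inverse (real (Suc m)) * real N ^ CARD('k) \<le> \<delta> * real N ^ CARD('k)"
        using m by (intro mult_right_mono) auto
      with N(2) have "visits {x. f x = 0} (box N) < \<delta> * real N ^ CARD('k)" by (rule less_le_trans)
      then show ?thesis using N(1) by blast
    qed
    then show "f \<in> {f :: 'a \<Rightarrow>\<^sub>C real. ocap T {x. f x = 0} = 0}"
      unfolding mem_Collect_eq ocap_eq_zero_iff by blast
  qed
  have open_O: "open (O' m)" for m
    unfolding O'_def by (intro open_UN ballI open_few_zeros)
  have dense_O: "closure (O' m) = UNIV" for m
  proof (intro set_eqI iffI UNIV_I)
    fix f :: "'a \<Rightarrow>\<^sub>C real"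
    show "f \<in> closure (O' m)"
      unfolding closure_approachable
    proof (intro allI impI)
      fix e :: real assume "0 < e"
      obtain g :: "'a \<Rightarrow> real" and N where g: "continuous_on UNIV g" "\<And>x. \<bar>g x - f x\<bar> \<le> e / 2"
        "1 \<le> N" "visits {x. g x = 0} (box N) < inverse (real (Suc m)) * real N ^ CARD('k)"
        using approximation_with_few_zeros[OF assms(2,3) continuous_on_apply_bcontfun half_gt_zero[OF \<open>0 < e\<close>],
            of "inverse (real (Suc m))" f] by auto
      \<comment> \<open>On a compact space continuity gives boundedness, so the bounded continuous
        functions are all of \<open>C(X)\<close>.\<close>
      have "g \<in> bcontfun"
        using g(1) compact_imp_bounded[OF compact_continuous_image[OF g(1) compact_space]]
        by (simp add: bcontfun_def)
      then obtain h :: "'a \<Rightarrow>\<^sub>C real" where h: "g = apply_bcontfun h" by (rule bcontfunE)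
      have "h \<in> O' m" using g(3,4) by (auto simp: O'_def h)
      moreover have "dist h f \<le> e / 2"
        by (rule dist_bound) (use g(2) in \<open>simp add: h dist_real_def\<close>)
      then have "dist h f < e" using \<open>0 < e\<close> by simp
      ultimately show "\<exists>h\<in>O' m. dist h f < e" by blast
    qed
  qed
  have "gdelta_in euclidean (\<Inter>(range O'))"
    by (intro gdelta_in_Inter) (use open_O in \<open>auto intro: open_imp_gdelta_in\<close>)
  \<comment> \<open>Baire applies because the space of bounded continuous functions is
    complete.\<close>
  moreover have "euclidean closure_of \<Inter>(range O') = topspace (euclidean :: ('a \<Rightarrow>\<^sub>C real) topology)"
    by (rule Baire_category) (use open_O dense_O completely_metrizable_space_euclidean in auto)
  ultimately show ?thesis unfolding eq by simp
qed

end
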